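(* Let $G$ be a countable discrete abelian group and let $(X,\mathcal B,\mu,(T_g)_{g\in G})$ be a measure-preserving $G$-system (not necessarily ergodic). Let $A\in\mathcal B$, $k\in\mathbb N$ and $\varepsilon>0$. There is a syndetic set $S\subseteq\mathrm{Hom}(G,G)^k$ such that for every $(\varphi_1,\dots,\varphi_k)\in S$ the set $$R_\varepsilon(\varphi_1,\dots,\varphi_k):=\Big\{g\in G:\mu\Big(\bigcap_{\omega\in\{0,1\}^k}T^{-1}_{(\omega_1\varphi_1+\cdots+\omega_k\varphi_k)(g)}A\Big)>\mu(A)^{2^k}-\varepsilon\Big\}$$ is syndetic in $G$.
   Context: $\mathrm{Hom}(G,G)$ is the abelian group of homomorphisms $G\to G$ under pointwise addition, with the topology of pointwise convergence ($\varphi_n\to\varphi$ iff for each $g$, $\varphi_n(g)=\varphi(g)$ eventually); it is a locally compact abelian group, and $\mathrm{Hom}(G,G)^k$ carries the product topology. A subset $S$ of a locally compact abelian group $\Gamma$ is syndetic if there is a compact $K\subseteq\Gamma$ with $S+K=\Gamma$; for discrete $G$ this means finitely many translates of $S$ cover $G$. *)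

theory Defs
  imports "HOL-Probability.Probability"
begin

definition mp_G_system :: "'x measure \<Rightarrow> ('g::ab_group_add \<Rightarrow> 'x \<Rightarrow> 'x) \<Rightarrow> bool" where
  "mp_G_system M T \<longleftrightarrow> prob_space M
     \<and> (\<forall>g. T g \<in> measurable M M \<and> distr M M (T g) = M)
     \<and> (\<forall>x\<in>space M. T 0 x = x)
     \<and> (\<forall>g h. \<forall>x\<in>space M. T (g + h) x = T g (T h x))"

definition Hom :: "('g::ab_group_add \<Rightarrow> 'g) set" where
  "Hom = {\<phi>. \<forall>x y. \<phi> (x + y) = \<phi> x + \<phi> y}"

definition hom_top :: "('g::ab_group_add \<Rightarrow> 'g) topology" where
  "hom_top = subtopology (product_topology (\<lambda>_. discrete_topology UNIV) UNIV) Hom"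

text \<open>Hom(G,G)^k with the product topology; k-tuples are functions on {..<k}
  (extensional, i.e. undefined outside {..<k}).\<close>
definition homk_top :: "nat \<Rightarrow> (nat \<Rightarrow> ('g::ab_group_add \<Rightarrow> 'g)) topology" where
  "homk_top k = product_topology (\<lambda>_. hom_top) {..<k}"

definition tuple_add :: "nat \<Rightarrow> (nat \<Rightarrow> ('g::ab_group_add \<Rightarrow> 'g)) \<Rightarrow> (nat \<Rightarrow> ('g \<Rightarrow> 'g))
    \<Rightarrow> (nat \<Rightarrow> ('g \<Rightarrow> 'g))" where
  "tuple_add k s c = restrict (\<lambda>i. \<lambda>g. s i g + c i g) {..<k}"

definition syndetic_homk :: "nat \<Rightarrow> (nat \<Rightarrow> ('g::ab_group_add \<Rightarrow> 'g)) set \<Rightarrow> bool" where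
  "syndetic_homk k S \<longleftrightarrow> (\<exists>K. compactin (homk_top k) K \<and>
      topspace (homk_top k) = {tuple_add k s c | s c. s \<in> S \<and> c \<in> K})"

definition syndetic_discrete :: "'g::ab_group_add set \<Rightarrow> bool" where
  "syndetic_discrete R \<longleftrightarrow> (\<exists>F. finite F \<and> (\<Union>f\<in>F. (\<lambda>r. f + r) ` R) = UNIV)"

text \<open>R_eps(phi_1..phi_k); omega in {0,1}^k is encoded as the subset of {..<k} where omega_i = 1.\<close>
definition R_eps :: "'x measure \<Rightarrow> ('g::ab_group_add \<Rightarrow> 'x \<Rightarrow> 'x) \<Rightarrow> 'x set \<Rightarrow> nat \<Rightarrow> real
    \<Rightarrow> (nat \<Rightarrow> ('g \<Rightarrow> 'g)) \<Rightarrow> 'g set" where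
  "R_eps M T A k \<epsilon> \<phi> = {g. measure M (\<Inter>\<omega>\<in>Pow {..<k}. T (\<Sum>i\<in>\<omega>. \<phi> i g) -` A \<inter> space M)
      > measure M A ^ (2 ^ k) - \<epsilon>}"

end

theory Submission
  imports Defs "HOL-Library.Function_Algebras"
begin

text \<open>
  Fix an invariant mean \<open>m\<close> on \<open>G\<close>. On \<open>G \<times> X\<close> with the finitely additive integral
  \<open>F \<mapsto> m\<^sub>g \<integral> F (g, x) d\<mu>\<close> the group \<open>Hom(G,G)\<close> acts by \<open>(g, x) \<mapsto> (g, T\<^bsub>\<phi>(g)\<^esub> x)\<close>, and the mean
  over \<open>g\<close> of the measures in the theorem is a cube correlation of this action. By Khintchine
  recurrence for cubes it exceeds \<open>\<mu>(A)\<^bsup>2^k\<^esup> - \<epsilon>/2\<close> for a syndetic (even for the discrete topology) set of tuples. For such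
  a tuple, the measures have almost the same average over all translates of a suitable finite
  pattern in \<open>G\<close>, because multiple averages along commuting actions converge uniformly (Walsh);
  hence large values occur syndetically. The same convergence, over \<open>Hom(G,G)\<^sup>k\<close>, gives the
  syndeticity in the Khintchine statement.

  Walsh's theorem is proved by induction on the number of actions, with an energy decrement that
  approximates the last function by structured ones: a function whose averages stay large correlates
  with an averaged dual function, and the averages of the latter reduce to averages of fewer actions.
  The argument is carried out for finitely additive systems, so that the uniformity needed in the
  induction step is the induction hypothesis for a system fibred over \<open>G\<close>.
\<close>

section \<open>Averages over lists\<close>

definition avg :: "'a list \<Rightarrow> ('a \<Rightarrow> real) \<Rightarrow> real" where
  "avg xs f = (\<Sum>x\<leftarrow>xs. f x) / real (length xs)"

definition convolve :: "'a::plus list \<Rightarrow> 'a list \<Rightarrow> 'a list" where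
  "convolve xs ys = map (\<lambda>(x, y). x + y) (List.product xs ys)"

lemma avg_const [simp]: "xs \<noteq> [] \<Longrightarrow> avg xs (\<lambda>_. c) = c"
  by (simp add: avg_def sum_list_triv)

lemma avg_add: "avg xs (\<lambda>x. f x + g x) = avg xs f + avg xs g"
  by (simp add: avg_def sum_list_addf add_divide_distrib)

lemma avg_diff: "avg xs (\<lambda>x. f x - g x) = avg xs f - avg xs g"
  by (simp add: avg_def sum_list_subtractf diff_divide_distrib)

lemma avg_cmult: "avg xs (\<lambda>x. c * f x) = c * avg xs f"
  by (simp add: avg_def sum_list_const_mult)

lemma avg_cmult_right: "avg xs (\<lambda>x. f x * c) = avg xs f * c"
  using avg_cmult[of xs c f] by (simp add: mult.commute)

lemma avg_mono: "(\<And>x. x \<in> set xs \<Longrightarrow> f x \<le> g x) \<Longrightarrow> avg xs f \<le> avg xs g"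
  by (auto simp: avg_def intro!: divide_right_mono sum_list_mono)

lemma avg_le: "xs \<noteq> [] \<Longrightarrow> (\<And>x. x \<in> set xs \<Longrightarrow> f x \<le> c) \<Longrightarrow> avg xs f \<le> c"
  using avg_mono[of xs f "\<lambda>_. c"] by simp

lemma avg_ge: "xs \<noteq> [] \<Longrightarrow> (\<And>x. x \<in> set xs \<Longrightarrow> c \<le> f x) \<Longrightarrow> c \<le> avg xs f"
  using avg_mono[of xs "\<lambda>_. c" f] by simp

lemma avg_abs_le:
  assumes "xs \<noteq> []" "\<And>x. \<bar>f x\<bar> \<le> c" shows "\<bar>avg xs f\<bar> \<le> c"
proof -
  have "f x \<le> c" "- c \<le> f x" for x using assms(2)[of x] by linarith+
  then show ?thesis
    using avg_le[of xs f c] avg_ge[of xs "- c" f] assms(1) by (simp add: abs_le_iff)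
qed

lemma avg_map: "avg (map h xs) f = avg xs (\<lambda>x. f (h x))"
  by (simp add: avg_def o_def)

lemma avg_swap: "avg xs (\<lambda>x. avg ys (\<lambda>y. f x y)) = avg ys (\<lambda>y. avg xs (\<lambda>x. f x y))"
proof -
  have "(\<Sum>x\<leftarrow>xs. \<Sum>y\<leftarrow>ys. f x y) = (\<Sum>y\<leftarrow>ys. \<Sum>x\<leftarrow>xs. f x y)"
    by (simp add: sum_list_sum_nth) (rule sum.swap)
  then show ?thesis
    by (simp add: avg_def divide_inverse sum_list_mult_const)
qed

lemma convolve_eq_Nil [simp]: "convolve xs ys = [] \<longleftrightarrow> xs = [] \<or> ys = []"
  by (metis convolve_def length_0_conv length_map length_product mult_eq_0_iff)

lemma avg_convolve: "avg (convolve xs ys) f = avg xs (\<lambda>x. avg ys (\<lambda>y. f (x + y)))"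
proof -
  have "(\<Sum>z\<leftarrow>convolve xs ys. f z) = (\<Sum>x\<leftarrow>xs. \<Sum>y\<leftarrow>ys. f (x + y))"
    by (induction xs) (auto simp: convolve_def o_def)
  then show ?thesis
    by (simp add: avg_def convolve_def divide_inverse sum_list_mult_const)
qed

lemma avg_convolve_right:
  fixes xs :: "'a::ab_semigroup_add list"
  shows "avg (convolve xs ys) f = avg ys (\<lambda>y. avg xs (\<lambda>x. f (x + y)))"
  unfolding avg_convolve by (rule avg_swap)

definition avg_shift_diff :: "'g::ab_group_add list \<Rightarrow> 'g \<Rightarrow> 'g \<Rightarrow> ('g \<Rightarrow> real) \<Rightarrow> real" where
  "avg_shift_diff xs h h' a = avg xs (\<lambda>g. a (g + h)) - avg xs (\<lambda>g. a (g + h'))"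

lemma avg_shift_diff_add:
  "avg_shift_diff xs h h' (\<lambda>g. a g + b g) = avg_shift_diff xs h h' a + avg_shift_diff xs h h' b"
  by (simp add: avg_shift_diff_def avg_add)

lemma avg_shift_diff_cmult: "avg_shift_diff xs h h' (\<lambda>g. c * a g) = c * avg_shift_diff xs h h' a"
  by (simp add: avg_shift_diff_def avg_cmult right_diff_distrib)

lemma avg_shift_diff_abs_le:
  assumes "xs \<noteq> []" "\<And>g. \<bar>a g\<bar> \<le> c" shows "\<bar>avg_shift_diff xs h h' a\<bar> \<le> 2 * c"
proof -
  have "\<bar>avg xs (\<lambda>g. a (g + k))\<bar> \<le> c" for k using assms by (rule avg_abs_le)
  from this[of h] this[of h'] show ?thesis unfolding avg_shift_diff_def by linarith
qed

lemma avg_shift_diff_convolve_left: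
  "avg_shift_diff (convolve xs ys) h h' a = avg ys (\<lambda>y. avg_shift_diff xs (y + h) (y + h') a)"
  by (simp add: avg_shift_diff_def avg_convolve_right avg_diff add.assoc)

lemma avg_shift_diff_convolve_right:
  "avg_shift_diff (convolve xs ys) h h' a = avg xs (\<lambda>x. avg_shift_diff ys (x + h) (x + h') a)"
  by (simp add: avg_shift_diff_def avg_convolve avg_diff algebra_simps)

section \<open>Means on algebras of bounded functions\<close>

definition bounded_fns :: "('i \<Rightarrow> real) set" where
  "bounded_fns = {a. bounded (range a)}"

lemma bounded_fnsI: "(\<And>i. \<bar>a i\<bar> \<le> C) \<Longrightarrow> a \<in> bounded_fns"
  by (auto simp: bounded_fns_def bounded_iff)

lemma bounded_fnsE:
  assumes "a \<in> bounded_fns" obtains C where "0 < C" "\<And>i. \<bar>a i\<bar> \<le> C"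
  using assms by (auto simp: bounded_fns_def bounded_pos)

lemma bounded_fns_compose: "a \<in> bounded_fns \<Longrightarrow> (\<lambda>i. a (h i)) \<in> bounded_fns"
  by (metis bounded_fnsE bounded_fnsI)

locale function_algebra =
  fixes V :: "('y \<Rightarrow> real) set"
  assumes V_bounded: "V \<subseteq> bounded_fns"
    and V_const: "(\<lambda>_. c) \<in> V"
    and V_add: "f \<in> V \<Longrightarrow> g \<in> V \<Longrightarrow> (\<lambda>y. f y + g y) \<in> V"
    and V_mult: "f \<in> V \<Longrightarrow> g \<in> V \<Longrightarrow> (\<lambda>y. f y * g y) \<in> V"
begin

lemma V_boundE: assumes "f \<in> V" obtains C where "0 < C" "\<And>y. \<bar>f y\<bar> \<le> C"
  using V_bounded assms bounded_fnsE by blast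

lemma V_cmult: "f \<in> V \<Longrightarrow> (\<lambda>y. c * f y) \<in> V"
  by (intro V_mult V_const)

lemma V_diff: "f \<in> V \<Longrightarrow> g \<in> V \<Longrightarrow> (\<lambda>y. f y - g y) \<in> V"
  using V_add[of f "\<lambda>y. (-1) * g y"] V_cmult[of g "-1"] by simp

lemma V_square: "f \<in> V \<Longrightarrow> (\<lambda>y. (f y)\<^sup>2) \<in> V"
  by (simp add: power2_eq_square V_mult)

lemma V_prod: "(\<And>j. j \<in> J \<Longrightarrow> f j \<in> V) \<Longrightarrow> (\<lambda>y. \<Prod>j\<in>J. f j y) \<in> V"
  by (induction J rule: infinite_finite_induct) (auto intro: V_mult V_const)

lemma V_sum_list: "(\<And>x. v x \<in> V) \<Longrightarrow> (\<lambda>y. \<Sum>x\<leftarrow>xs. v x y) \<in> V"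
  by (induction xs) (auto intro: V_add V_const)

lemma V_avg: "(\<And>x. v x \<in> V) \<Longrightarrow> (\<lambda>y. avg xs (\<lambda>x. v x y)) \<in> V"
  unfolding avg_def using V_cmult[OF V_sum_list, of v "1 / real (length xs)" xs] by simp

lemma V_avg_shift_diff: "(\<And>x. v x \<in> V) \<Longrightarrow> (\<lambda>y. avg_shift_diff xs h h' (\<lambda>x. v x y)) \<in> V"
  unfolding avg_shift_diff_def by (intro V_diff V_avg)

lemmas V_intros = V_const V_add V_diff V_mult V_square V_avg V_avg_shift_diff V_prod

end

interpretation bounded_fns: function_algebra bounded_fns
proof
  fix f g :: "'i \<Rightarrow> real" assume "f \<in> bounded_fns" "g \<in> bounded_fns"
  then obtain C D where C: "\<And>i. \<bar>f i\<bar> \<le> C" and D: "\<And>i. \<bar>g i\<bar> \<le> D"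
    by (metis bounded_fnsE)
  have "\<bar>f i + g i\<bar> \<le> C + D" for i using C[of i] D[of i] by linarith
  then show "(\<lambda>i. f i + g i) \<in> bounded_fns" by (rule bounded_fnsI)
  have "\<bar>f i * g i\<bar> \<le> C * D" for i
    unfolding abs_mult using C[of i] D[of i] by (intro mult_mono) auto
  then show "(\<lambda>i. f i * g i) \<in> bounded_fns" by (rule bounded_fnsI)
qed (auto intro: bounded_fnsI)

definition L2norm :: "(('y \<Rightarrow> real) \<Rightarrow> real) \<Rightarrow> ('y \<Rightarrow> real) \<Rightarrow> real" where
  "L2norm I f = sqrt (I (\<lambda>y. (f y)\<^sup>2))"

locale mean = function_algebra V for V :: "('y \<Rightarrow> real) set" +
  fixes I :: "('y \<Rightarrow> real) \<Rightarrow> real"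
  assumes I_add: "f \<in> V \<Longrightarrow> g \<in> V \<Longrightarrow> I (\<lambda>y. f y + g y) = I f + I g"
    and I_cmult: "f \<in> V \<Longrightarrow> I (\<lambda>y. c * f y) = c * I f"
    and I_nonneg: "f \<in> V \<Longrightarrow> (\<And>y. 0 \<le> f y) \<Longrightarrow> 0 \<le> I f"
    and I_one: "I (\<lambda>_. 1) = 1"
begin

lemma I_const [simp]: "I (\<lambda>_. c) = c"
  using I_cmult[OF V_const, of c 1] I_one by simp

lemma I_diff: "f \<in> V \<Longrightarrow> g \<in> V \<Longrightarrow> I (\<lambda>y. f y - g y) = I f - I g"
  using I_add[of f "\<lambda>y. (-1) * g y"] I_cmult[of g "-1"] V_cmult[of g "-1"] by simp

lemma I_sum_list: "(\<And>x. v x \<in> V) \<Longrightarrow> I (\<lambda>y. \<Sum>x\<leftarrow>xs. v x y) = (\<Sum>x\<leftarrow>xs. I (v x))"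
  by (induction xs) (auto simp: I_add V_sum_list)

lemma I_avg: "(\<And>x. v x \<in> V) \<Longrightarrow> I (\<lambda>y. avg xs (\<lambda>x. v x y)) = avg xs (\<lambda>x. I (v x))"
  unfolding avg_def using I_cmult[OF V_sum_list, of v "1 / real (length xs)" xs]
  by (simp add: I_sum_list)

lemma I_avg_shift_diff:
  "(\<And>x. v x \<in> V) \<Longrightarrow>
    I (\<lambda>y. avg_shift_diff xs h h' (\<lambda>x. v x y)) = avg_shift_diff xs h h' (\<lambda>x. I (v x))"
  unfolding avg_shift_diff_def by (simp add: I_diff I_avg V_avg)

lemma I_mono: assumes "f \<in> V" "g \<in> V" "\<And>y. f y \<le> g y" shows "I f \<le> I g"
  using I_nonneg[of "\<lambda>y. g y - f y"] I_diff[of g f] V_diff[of g f] assms by simp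

lemma I_le: "f \<in> V \<Longrightarrow> (\<And>y. f y \<le> c) \<Longrightarrow> I f \<le> c"
  using I_mono[OF _ V_const, of f c] by simp

lemma I_ge: "f \<in> V \<Longrightarrow> (\<And>y. c \<le> f y) \<Longrightarrow> c \<le> I f"
  using I_mono[OF V_const, of f c] by simp

lemma I_abs_le: assumes "f \<in> V" "\<And>y. \<bar>f y\<bar> \<le> c" shows "\<bar>I f\<bar> \<le> c"
proof -
  have "f y \<le> c" "- c \<le> f y" for y using assms(2)[of y] by linarith+
  then show ?thesis using I_le[of f c] I_ge[of f "- c"] assms(1) by (auto simp: abs_le_iff)
qed

abbreviation norm2 :: "('y \<Rightarrow> real) \<Rightarrow> real" where
  "norm2 \<equiv> L2norm I"

lemma norm2_nonneg: "f \<in> V \<Longrightarrow> 0 \<le> norm2 f"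
  by (simp add: L2norm_def I_nonneg V_square)

lemma norm2_square: "f \<in> V \<Longrightarrow> (norm2 f)\<^sup>2 = I (\<lambda>y. (f y)\<^sup>2)"
  by (simp add: L2norm_def I_nonneg V_square)

lemma norm2_const [simp]: "norm2 (\<lambda>_. c) = \<bar>c\<bar>"
  by (simp add: L2norm_def)

lemma I_square_add:
  assumes "f \<in> V" "g \<in> V"
  shows "I (\<lambda>y. (f y + t * g y)\<^sup>2)
    = I (\<lambda>y. (f y)\<^sup>2) + 2 * t * I (\<lambda>y. f y * g y) + t\<^sup>2 * I (\<lambda>y. (g y)\<^sup>2)"
proof -
  have "I (\<lambda>y. (f y + t * g y)\<^sup>2) = I (\<lambda>y. ((f y)\<^sup>2 + (2 * t) * (f y * g y)) + t\<^sup>2 * (g y)\<^sup>2)"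
    by (intro arg_cong[where f=I] ext) (simp add: power2_eq_square algebra_simps)
  also have "\<dots> = I (\<lambda>y. (f y)\<^sup>2) + 2 * t * I (\<lambda>y. f y * g y) + t\<^sup>2 * I (\<lambda>y. (g y)\<^sup>2)"
    by (simp only: I_add I_cmult V_intros assms)
  finally show ?thesis .
qed

lemma I_square_midpoint:
  assumes "f \<in> V" "g \<in> V"
  shows "I (\<lambda>y. ((f y + g y) / 2)\<^sup>2)
    = (I (\<lambda>y. (f y)\<^sup>2) + 2 * I (\<lambda>y. f y * g y) + I (\<lambda>y. (g y)\<^sup>2)) / 4"
proof -
  have "I (\<lambda>y. ((f y + g y) / 2)\<^sup>2) = I (\<lambda>y. 1 / 4 * (f y + g y)\<^sup>2)"
    by (simp add: power_divide)
  also have "\<dots> = 1 / 4 * I (\<lambda>y. (f y + g y)\<^sup>2)" by (intro I_cmult V_square V_add assms)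
  finally show ?thesis using I_square_add[OF assms, of 1] by simp
qed

lemma Cauchy_Schwarz:
  assumes "f \<in> V" "g \<in> V" shows "\<bar>I (\<lambda>y. f y * g y)\<bar> \<le> norm2 f * norm2 g"
proof -
  let ?a = "I (\<lambda>y. (f y)\<^sup>2)" and ?b = "I (\<lambda>y. f y * g y)" and ?c = "I (\<lambda>y. (g y)\<^sup>2)"
  have quadratic: "0 \<le> ?a + 2 * t * ?b + t\<^sup>2 * ?c" for t
    unfolding I_square_add[OF assms, symmetric] by (intro I_nonneg V_intros assms) auto
  have "0 \<le> ?c" by (intro I_nonneg V_intros assms) auto
  have "?b\<^sup>2 \<le> ?a * ?c"
  proof (cases "?c = 0")
    case True
    have "?b = 0"
    proof (rule ccontr)
      assume "?b \<noteq> 0"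
      then have "2 * (- (?a + 1) / (2 * ?b)) * ?b = - (?a + 1)" by simp
      then show False using quadratic[of "- (?a + 1) / (2 * ?b)"] True by simp
    qed
    then show ?thesis using True by simp
  next
    case False
    then show ?thesis
      using \<open>0 \<le> ?c\<close> quadratic[of "- ?b / ?c"] by (simp add: field_simps power2_eq_square)
  qed
  then have "\<bar>?b\<bar> \<le> sqrt (?a * ?c)" by (intro real_le_rsqrt) simp
  then show ?thesis by (simp add: L2norm_def real_sqrt_mult)
qed

lemma I_mult_le: "f \<in> V \<Longrightarrow> g \<in> V \<Longrightarrow> I (\<lambda>y. f y * g y) \<le> norm2 f * norm2 g"
  using Cauchy_Schwarz by (rule abs_le_D1)

lemma I_abs_le_norm2: "f \<in> V \<Longrightarrow> \<bar>I f\<bar> \<le> norm2 f"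
  using Cauchy_Schwarz[OF _ V_const, of f 1] by simp

lemma I_power2_le: "f \<in> V \<Longrightarrow> (I f)\<^sup>2 \<le> I (\<lambda>y. (f y)\<^sup>2)"
  using I_abs_le_norm2 by (metis abs_ge_zero norm2_square power2_abs power_mono)

lemma I_power_two_power_le:
  assumes "f \<in> V" "\<And>y. 0 \<le> f y"
  shows "I f ^ (2 ^ k) \<le> I (\<lambda>y. f y ^ (2 ^ k)) \<and> (\<lambda>y. f y ^ (2 ^ k)) \<in> V"
proof (induction k)
  case 0 then show ?case using assms by simp
next
  case (Suc k)
  have "I f ^ (2 ^ Suc k) = (I f ^ (2 ^ k))\<^sup>2" by (simp add: power_even_eq)
  also have "\<dots> \<le> (I (\<lambda>y. f y ^ (2 ^ k)))\<^sup>2"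
    using Suc I_nonneg[OF assms] by (intro power_mono) auto
  also have "\<dots> \<le> I (\<lambda>y. (f y ^ (2 ^ k))\<^sup>2)" using Suc by (intro I_power2_le) simp
  finally show ?case using Suc V_square by (simp add: power_even_eq)
qed

lemma norm2_leI:
  assumes "f \<in> V" "0 \<le> B" "I (\<lambda>y. f y * f y) \<le> B * norm2 f" shows "norm2 f \<le> B"
proof (cases "norm2 f = 0")
  case False
  then have "norm2 f > 0" using norm2_nonneg[OF assms(1)] by simp
  moreover have "norm2 f * norm2 f \<le> B * norm2 f"
    using assms norm2_square[OF assms(1)] by (simp add: power2_eq_square)
  ultimately show ?thesis by simp
qed (use assms in simp)

lemma norm2_triangle:
  assumes "f \<in> V" "g \<in> V" shows "norm2 (\<lambda>y. f y + g y) \<le> norm2 f + norm2 g"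
proof (rule norm2_leI)
  let ?s = "\<lambda>y. f y + g y"
  show s: "?s \<in> V" using assms by (rule V_add)
  show "0 \<le> norm2 f + norm2 g" using assms norm2_nonneg by simp
  have "I (\<lambda>y. ?s y * ?s y) = I (\<lambda>y. f y * ?s y) + I (\<lambda>y. g y * ?s y)"
    unfolding distrib_right[of _ _ "?s _"] by (intro I_add V_mult assms s)
  also have "\<dots> \<le> norm2 f * norm2 ?s + norm2 g * norm2 ?s"
    using assms s by (intro add_mono I_mult_le)
  finally show "I (\<lambda>y. ?s y * ?s y) \<le> (norm2 f + norm2 g) * norm2 ?s"
    by (simp add: distrib_right)
qed

lemma norm2_cmult: "f \<in> V \<Longrightarrow> norm2 (\<lambda>y. c * f y) = \<bar>c\<bar> * norm2 f"
  by (simp add: L2norm_def power_mult_distrib I_cmult V_square real_sqrt_mult)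

lemma norm2_triangle_diff:
  assumes "f \<in> V" "g \<in> V" shows "norm2 (\<lambda>y. f y - g y) \<le> norm2 f + norm2 g"
  using norm2_triangle[OF assms(1) V_cmult[OF assms(2), of "-1"]] norm2_cmult[OF assms(2), of "-1"]
  by simp

lemma norm2_mult_le:
  assumes "f \<in> V" "g \<in> V" "\<And>y. \<bar>f y\<bar> \<le> C" shows "norm2 (\<lambda>y. f y * g y) \<le> C * norm2 g"
proof -
  have "0 \<le> C" using assms(3) abs_ge_zero order_trans by blast
  have "(f y)\<^sup>2 \<le> C\<^sup>2" for y using assms(3)[of y] power_mono[of "\<bar>f y\<bar>" C 2] by simp
  then have "I (\<lambda>y. (f y * g y)\<^sup>2) \<le> I (\<lambda>y. C\<^sup>2 * (g y)\<^sup>2)"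
    by (intro I_mono V_intros assms) (auto simp: power_mult_distrib intro!: mult_right_mono)
  also have "\<dots> = C\<^sup>2 * I (\<lambda>y. (g y)\<^sup>2)" by (intro I_cmult V_intros assms)
  finally have "norm2 (\<lambda>y. f y * g y) \<le> sqrt (C\<^sup>2 * I (\<lambda>y. (g y)\<^sup>2))" by (simp add: L2norm_def)
  then show ?thesis using \<open>0 \<le> C\<close> by (simp add: L2norm_def real_sqrt_mult)
qed

lemma norm2_avg_le:
  assumes "xs \<noteq> []" "\<And>x. v x \<in> V" "\<And>x. norm2 (v x) \<le> B"
  shows "norm2 (\<lambda>y. avg xs (\<lambda>x. v x y)) \<le> B"
proof (rule norm2_leI)
  let ?w = "\<lambda>y. avg xs (\<lambda>x. v x y)"
  show w: "?w \<in> V" using assms(2) by (rule V_avg)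
  show "0 \<le> B" using assms(2,3) norm2_nonneg order_trans by blast
  have "I (\<lambda>y. ?w y * ?w y) = avg xs (\<lambda>x. I (\<lambda>y. v x y * ?w y))"
    unfolding avg_cmult_right[symmetric] by (intro I_avg V_mult w assms(2))
  also have "\<dots> \<le> B * norm2 ?w"
  proof (intro avg_le assms(1))
    fix x
    have "I (\<lambda>y. v x y * ?w y) \<le> norm2 (v x) * norm2 ?w" using assms(2) w by (rule I_mult_le)
    also have "\<dots> \<le> B * norm2 ?w" using assms(3) norm2_nonneg[OF w] by (rule mult_right_mono)
    finally show "I (\<lambda>y. v x y * ?w y) \<le> B * norm2 ?w" .
  qed
  finally show "I (\<lambda>y. ?w y * ?w y) \<le> B * norm2 ?w" .
qed

end

lemma abs_le_if_quadratic_le: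
  fixes b n e :: real
  assumes quadratic: "\<And>t. 2 * t * b - t\<^sup>2 * n\<^sup>2 \<le> e\<^sup>2" and "0 \<le> n" "0 \<le> e"
  shows "\<bar>b\<bar> \<le> e * n"
proof (cases "n = 0")
  case True
  have "b = 0"
  proof (rule ccontr)
    assume "b \<noteq> 0"
    then have "2 * ((e\<^sup>2 + 1) / (2 * b)) * b = e\<^sup>2 + 1" by simp
    then show False using quadratic[of "(e\<^sup>2 + 1) / (2 * b)"] True by simp
  qed
  then show ?thesis using True by simp
next
  case False
  then have "b\<^sup>2 / n\<^sup>2 \<le> e\<^sup>2"
    using quadratic[of "b / n\<^sup>2"] by (simp add: power2_eq_square field_simps)
  then have "b\<^sup>2 \<le> (e * n)\<^sup>2" using False by (simp add: field_simps power_mult_distrib)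
  then show ?thesis using \<open>0 \<le> n\<close> \<open>0 \<le> e\<close> by (simp flip: abs_le_square_iff)
qed

context mean
begin

text \<open>\<^term>\<open>V\<close> is not complete, so functionals are represented up to an error.\<close>

lemma approximate_Riesz:
  assumes add: "\<And>f g. f \<in> V \<Longrightarrow> g \<in> V \<Longrightarrow> l (\<lambda>y. f y + g y) = l f + l g"
    and cmult: "\<And>f c. f \<in> V \<Longrightarrow> l (\<lambda>y. c * f y) = c * l f"
    and bound: "\<And>f. f \<in> V \<Longrightarrow> \<bar>l f\<bar> \<le> C * norm2 f" and "0 < e"
  obtains z where "z \<in> V" "\<And>q. q \<in> V \<Longrightarrow> \<bar>l q - I (\<lambda>y. q y * z y)\<bar> \<le> e * norm2 q"
proof -
  define J where "J z = 2 * l z - I (\<lambda>y. (z y)\<^sup>2)" for z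
  have "J z \<le> C\<^sup>2" if "z \<in> V" for z
  proof -
    have "J z \<le> 2 * (C * norm2 z) - (norm2 z)\<^sup>2"
      using bound[OF that] norm2_square[OF that] by (simp add: J_def)
    also have "\<dots> \<le> C\<^sup>2"
      using zero_le_power2[of "C - norm2 z"] by (simp add: power2_eq_square algebra_simps)
    finally show ?thesis .
  qed
  then have bdd: "bdd_above (J ` V)" by (auto intro!: bdd_aboveI)
  have "J ` V \<noteq> {}" using V_const by auto
  then obtain z where z: "z \<in> V" "Sup (J ` V) - e\<^sup>2 < J z"
    using less_cSupD[of "J ` V" "Sup (J ` V) - e\<^sup>2"] \<open>0 < e\<close> by auto
  have "\<bar>l q - I (\<lambda>y. q y * z y)\<bar> \<le> e * norm2 q" if q: "q \<in> V" for q
  proof (rule abs_le_if_quadratic_le)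
    fix t
    have "J (\<lambda>y. z y + t * q y) \<le> Sup (J ` V)"
      using bdd z q by (intro cSup_upper imageI V_add V_cmult) auto
    moreover have "J (\<lambda>y. z y + t * q y) = J z + 2 * t * (l q - I (\<lambda>y. q y * z y)) - t\<^sup>2 * (norm2 q)\<^sup>2"
      unfolding J_def I_square_add[OF z(1) q] norm2_square[OF q]
      using add[OF z(1) V_cmult[OF q]] cmult[OF q] by (simp add: algebra_simps)
    ultimately show "2 * t * (l q - I (\<lambda>y. q y * z y)) - t\<^sup>2 * (norm2 q)\<^sup>2 \<le> e\<^sup>2"
      using z by simp
  qed (use \<open>0 < e\<close> norm2_nonneg[OF q] in auto)
  with z(1) show ?thesis using that by blast
qed

lemma norm2_Riesz_representative_le:
  assumes "z \<in> V" "\<bar>l z\<bar> \<le> C * norm2 z" "\<bar>l z - I (\<lambda>y. z y * z y)\<bar> \<le> e * norm2 z" "0 \<le> C + e"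
  shows "norm2 z \<le> C + e"
proof (rule norm2_leI)
  show "I (\<lambda>y. z y * z y) \<le> (C + e) * norm2 z"
    using assms(2,3) unfolding distrib_right by linarith
qed (use assms in auto)

lemma I_square_subtract_correlate:
  assumes "r \<in> V" "z \<in> V" "norm2 z \<le> C" "0 < C" "0 \<le> \<delta>" "\<delta> \<le> I (\<lambda>y. r y * z y)"
  shows "I (\<lambda>y. (r y - \<delta> / C\<^sup>2 * z y)\<^sup>2) \<le> I (\<lambda>y. (r y)\<^sup>2) - (\<delta> / C)\<^sup>2"
proof -
  define t where "t = \<delta> / C\<^sup>2"
  have "0 \<le> t" using assms(4,5) by (simp add: t_def)
  have "I (\<lambda>y. (z y)\<^sup>2) \<le> C\<^sup>2"
    using norm2_square[OF assms(2)] norm2_nonneg[OF assms(2)] assms(3) by (metis power_mono)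
  then have "t\<^sup>2 * I (\<lambda>y. (z y)\<^sup>2) \<le> t\<^sup>2 * C\<^sup>2" by (rule mult_left_mono) simp
  moreover have "t * \<delta> \<le> t * I (\<lambda>y. r y * z y)" using assms(6) \<open>0 \<le> t\<close> by (rule mult_left_mono)
  moreover have "t * \<delta> = (\<delta> / C)\<^sup>2" "t\<^sup>2 * C\<^sup>2 = (\<delta> / C)\<^sup>2"
    using assms(4) by (simp_all add: t_def power2_eq_square)
  ultimately show ?thesis
    using I_square_add[OF assms(1,2), of "- t"] by (simp add: t_def)
qed

context
  fixes P :: "real \<Rightarrow> ('y \<Rightarrow> real) \<Rightarrow> bool" and u :: "'y \<Rightarrow> real" and e C \<delta> :: real
  assumes add: "\<And>a b u v. u \<in> V \<Longrightarrow> v \<in> V \<Longrightarrow> P a u \<Longrightarrow> P b v \<Longrightarrow> P (a + b) (\<lambda>y. u y + v y)"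
    and cmult: "\<And>a c u. u \<in> V \<Longrightarrow> P a u \<Longrightarrow> P (\<bar>c\<bar> * a) (\<lambda>y. c * u y)"
    and mono: "\<And>a b u. P a u \<Longrightarrow> a \<le> b \<Longrightarrow> P b u"
    and zero: "P 0 (\<lambda>_. 0)"
    and correlate: "\<And>r a. r \<in> V \<Longrightarrow> norm2 r \<le> norm2 u \<Longrightarrow> \<not> P (e / 2) r \<Longrightarrow> 0 < a \<Longrightarrow>
      \<exists>z\<in>V. P a z \<and> norm2 z \<le> C \<and> \<delta> \<le> I (\<lambda>y. r y * z y)"
    and u: "u \<in> V" and pos: "0 < e" "0 < \<delta>" "0 < C"
begin

text \<open>As long as the error of an approximation by a good function fails \<^term>\<open>P\<close>, it correlates with
  a good function, and subtracting a multiple of that function decreases its energy.\<close>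

lemma energy_decrement_step:
  assumes "\<not> P e u" and s: "s \<in> V" "P b s" "b \<le> e / 2" "I (\<lambda>y. (u y - s y)\<^sup>2) \<le> I (\<lambda>y. (u y)\<^sup>2)"
    and "0 < a"
  shows "\<exists>s'\<in>V. P (b + a) s' \<and> I (\<lambda>y. (u y - s' y)\<^sup>2) \<le> I (\<lambda>y. (u y - s y)\<^sup>2) - (\<delta> / C)\<^sup>2"
proof -
  define r where "r y = u y - s y" for y
  have r: "r \<in> V" unfolding r_def[abs_def] by (intro V_diff u s)
  have "norm2 r \<le> norm2 u" using s(4) by (simp add: L2norm_def r_def)
  have "\<not> P (e / 2) r"
  proof
    assume "P (e / 2) r"
    then have "P (b + e / 2) (\<lambda>y. s y + r y)" by (intro add s r)
    then have "P e (\<lambda>y. s y + r y)" by (rule mono) (use s(3) in simp)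
    then show False using \<open>\<not> P e u\<close> by (simp add: r_def)
  qed
  define t where "t = \<delta> / C\<^sup>2"
  have "0 < t" using pos by (simp add: t_def)
  then have "0 < a / t" using \<open>0 < a\<close> by simp
  then obtain z where z: "z \<in> V" "P (a / t) z" "norm2 z \<le> C" "\<delta> \<le> I (\<lambda>y. r y * z y)"
    using correlate[OF r \<open>norm2 r \<le> norm2 u\<close> \<open>\<not> P (e / 2) r\<close>] by blast
  have "P (b + \<bar>t\<bar> * (a / t)) (\<lambda>y. s y + t * z y)" by (intro add cmult V_cmult s z)
  then have "P (b + a) (\<lambda>y. s y + t * z y)" using \<open>0 < t\<close> by simp
  moreover have "I (\<lambda>y. (u y - (s y + t * z y))\<^sup>2) \<le> I (\<lambda>y. (u y - s y)\<^sup>2) - (\<delta> / C)\<^sup>2"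
    using I_square_subtract_correlate[OF r z(1,3) pos(3) less_imp_le[OF pos(2)] z(4)]
    by (simp add: r_def t_def diff_diff_eq)
  ultimately show ?thesis by (intro bexI[of _ "\<lambda>y. s y + t * z y"] V_add V_cmult s z) simp
qed

lemma energy_decrement: "P e u"
proof (rule ccontr)
  assume "\<not> P e u"
  have approximation: "\<exists>s\<in>V. P a s \<and> I (\<lambda>y. (u y - s y)\<^sup>2) \<le> I (\<lambda>y. (u y)\<^sup>2) - real n * (\<delta> / C)\<^sup>2"
    if "0 < a" for a n
    using that
  proof (induction n arbitrary: a)
    case 0
    have "P a (\<lambda>_. 0)" using zero 0 mono[of 0 "\<lambda>_. 0" a] by simp
    then show ?case by (intro bexI[of _ "\<lambda>_. 0"] V_const) simp
  next
    case (Suc n)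
    define b where "b = min (a / 2) (e / 2)"
    have b: "0 < b" "b \<le> e / 2" "b + a / 2 \<le> a" using pos \<open>0 < a\<close> by (auto simp: b_def)
    obtain s where s: "s \<in> V" "P b s"
      "I (\<lambda>y. (u y - s y)\<^sup>2) \<le> I (\<lambda>y. (u y)\<^sup>2) - real n * (\<delta> / C)\<^sup>2"
      using Suc.IH b(1) by blast
    have "0 \<le> real n * (\<delta> / C)\<^sup>2" by simp
    then have "I (\<lambda>y. (u y - s y)\<^sup>2) \<le> I (\<lambda>y. (u y)\<^sup>2)" using s(3) by linarith
    then obtain s' where s': "s' \<in> V" "P (b + a / 2) s'"
      "I (\<lambda>y. (u y - s' y)\<^sup>2) \<le> I (\<lambda>y. (u y - s y)\<^sup>2) - (\<delta> / C)\<^sup>2"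
      using energy_decrement_step[OF \<open>\<not> P e u\<close> s(1,2) b(2), of "a / 2"] \<open>0 < a\<close> by auto
    then have "P a s'" using mono b(3) by blast
    moreover have "I (\<lambda>y. (u y - s' y)\<^sup>2) \<le> I (\<lambda>y. (u y)\<^sup>2) - real (Suc n) * (\<delta> / C)\<^sup>2"
      using s(3) s'(3) by (simp add: distrib_right)
    ultimately show ?case using s'(1) by blast
  qed
  have "0 < (\<delta> / C)\<^sup>2" using pos by simp
  then obtain n where n: "I (\<lambda>y. (u y)\<^sup>2) < real n * (\<delta> / C)\<^sup>2" using reals_Archimedean3 by blast
  obtain s where "s \<in> V" "I (\<lambda>y. (u y - s y)\<^sup>2) \<le> I (\<lambda>y. (u y)\<^sup>2) - real n * (\<delta> / C)\<^sup>2"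
    using approximation[of 1 n] by auto
  moreover have "0 \<le> I (\<lambda>y. (u y - s y)\<^sup>2)" using \<open>s \<in> V\<close> u by (intro I_nonneg V_intros) auto
  ultimately show False using n by linarith
qed

end

end

subsection \<open>Integrals of means\<close>

definition fibre_fns :: "('i \<Rightarrow> 'y \<Rightarrow> 'z) \<Rightarrow> ('y \<Rightarrow> real) set \<Rightarrow> ('z \<Rightarrow> real) set" where
  "fibre_fns \<iota> V = {F \<in> bounded_fns. \<forall>i. (\<lambda>y. F (\<iota> i y)) \<in> V}"

definition fibre_mean ::
    "('i \<Rightarrow> 'y \<Rightarrow> 'z) \<Rightarrow> (('i \<Rightarrow> real) \<Rightarrow> real) \<Rightarrow> (('y \<Rightarrow> real) \<Rightarrow> real) \<Rightarrow> ('z \<Rightarrow> real) \<Rightarrow> real" where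
  "fibre_mean \<iota> m I F = m (\<lambda>i. I (\<lambda>y. F (\<iota> i y)))"

lemma fibre_fns_bounded_fns [simp]: "fibre_fns \<iota> bounded_fns = bounded_fns"
  by (auto simp: fibre_fns_def intro: bounded_fns_compose)

lemma function_algebra_fibre_fns: "function_algebra V \<Longrightarrow> function_algebra (fibre_fns \<iota> V)"
  by (auto simp: function_algebra_def fibre_fns_def
      intro: bounded_fns.V_const bounded_fns.V_add bounded_fns.V_mult)

lemma (in mean) fibre_integral_bounded:
  assumes "F \<in> fibre_fns \<iota> V" shows "(\<lambda>i. I (\<lambda>y. F (\<iota> i y))) \<in> bounded_fns"
proof -
  have "F \<in> bounded_fns" using assms by (simp add: fibre_fns_def)
  then obtain C where "\<And>z. \<bar>F z\<bar> \<le> C" using bounded_fnsE by blast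
  then show ?thesis using assms by (intro bounded_fnsI[of _ C] I_abs_le) (auto simp: fibre_fns_def)
qed

lemma mean_fibre_mean:
  assumes "mean V I" "mean bounded_fns m"
  shows "mean (fibre_fns \<iota> V) (fibre_mean \<iota> m I)"
proof -
  interpret mean V I by fact
  interpret m: mean bounded_fns m by fact
  interpret function_algebra "fibre_fns \<iota> V"
    by (rule function_algebra_fibre_fns) unfold_locales
  show ?thesis
  proof
    fix F F' assume F: "F \<in> fibre_fns \<iota> V" "F' \<in> fibre_fns \<iota> V"
    then have "(\<lambda>y. F (\<iota> i y)) \<in> V" "(\<lambda>y. F' (\<iota> i y)) \<in> V" for i by (auto simp: fibre_fns_def)
    then show "fibre_mean \<iota> m I (\<lambda>z. F z + F' z) = fibre_mean \<iota> m I F + fibre_mean \<iota> m I F'"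
      unfolding fibre_mean_def using F by (simp add: I_add m.I_add fibre_integral_bounded)
  next
    fix F c assume F: "F \<in> fibre_fns \<iota> V"
    then have "(\<lambda>y. F (\<iota> i y)) \<in> V" for i by (auto simp: fibre_fns_def)
    then show "fibre_mean \<iota> m I (\<lambda>z. c * F z) = c * fibre_mean \<iota> m I F"
      unfolding fibre_mean_def using F by (simp add: I_cmult m.I_cmult fibre_integral_bounded)
  next
    fix F :: "'c \<Rightarrow> real" assume F: "F \<in> fibre_fns \<iota> V" "\<And>z. 0 \<le> F z"
    then show "0 \<le> fibre_mean \<iota> m I F"
      unfolding fibre_mean_def
      by (intro m.I_nonneg I_nonneg fibre_integral_bounded) (auto simp: fibre_fns_def)
  qed (simp add: fibre_mean_def)
qed

subsection \<open>Cluster points of means\<close>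

lemma closed_mem_cluster_point:
  assumes "closed S" "eventually (\<lambda>x. x \<in> S) F" "inf (nhds x) F \<noteq> bot"
  shows "x \<in> S"
proof (rule ccontr)
  assume "x \<notin> S"
  then have "eventually (\<lambda>y. y \<in> - S) (nhds x)"
    using assms(1) by (intro eventually_nhds_in_open) auto
  then have "eventually (\<lambda>_. False) (inf (nhds x) F)" using assms(2) by (auto simp: eventually_inf)
  then show False using assms(3) by (simp add: eventually_False)
qed

lemma compact_PiE_UNIV:
  fixes K :: "'a \<Rightarrow> 'b::topological_space set"
  assumes "\<And>a. compact (K a)" shows "compact (\<Pi>\<^sub>E a\<in>UNIV. K a)"
proof -
  have "compactin (product_topology (\<lambda>_. euclidean) UNIV) (\<Pi>\<^sub>E a\<in>UNIV. K a)"
    using assms by (subst compactin_PiE) auto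
  then show ?thesis by (simp add: euclidean_product_topology)
qed

lemma closed_Collect_mean:
  assumes "function_algebra V" shows "closed {L. mean V L}"
proof -
  have eval: "continuous_on UNIV (\<lambda>L. L f)" for f :: "'a \<Rightarrow> real"
    by (rule continuous_on_product_coordinates)
  have "mean V L \<longleftrightarrow> (\<forall>f g. f \<in> V \<longrightarrow> g \<in> V \<longrightarrow> L (\<lambda>y. f y + g y) = L f + L g)
      \<and> (\<forall>f c. f \<in> V \<longrightarrow> L (\<lambda>y. c * f y) = c * L f)
      \<and> (\<forall>f. f \<in> V \<longrightarrow> (\<forall>y. 0 \<le> f y) \<longrightarrow> 0 \<le> L f) \<and> L (\<lambda>_. 1) = 1" for L
    using assms by (auto simp: mean_def mean_axioms_def)
  then show ?thesis
    by (simp only:) (intro closed_Collect_conj closed_Collect_all closed_Collect_imp open_Collect_const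
        closed_Collect_eq closed_Collect_le continuous_intros eval)
qed

lemma (in mean) mean_restrict: "mean V (\<lambda>f. if f \<in> V then I f else 0)"
  by unfold_locales (simp_all add: V_add V_cmult V_const I_add I_cmult I_nonneg)

lemma ex_cluster_mean:
  fixes \<Lambda> :: "'e \<Rightarrow> ('y \<Rightarrow> real) \<Rightarrow> real"
  assumes "F \<noteq> bot" "function_algebra V" and means: "eventually (\<lambda>e. mean V (\<Lambda> e)) F"
  obtains L where "mean V L"
    "\<And>f c. f \<in> V \<Longrightarrow> eventually (\<lambda>e. c \<le> \<Lambda> e f) F \<Longrightarrow> c \<le> L f"
proof -
  interpret function_algebra V by fact
  have "\<forall>f\<in>V. \<exists>C. \<forall>y. \<bar>f y\<bar> \<le> C" using V_boundE by metis
  then obtain C where C: "\<And>f y. f \<in> V \<Longrightarrow> \<bar>f y\<bar> \<le> C f" unfolding bchoice_iff by blast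
  define \<Lambda>\<^sub>V where "\<Lambda>\<^sub>V e f = (if f \<in> V then \<Lambda> e f else 0)" for e f
  define K where "K = (\<Pi>\<^sub>E f\<in>UNIV. (if f \<in> V then {- C f..C f} else {0}))"
  have "compact K" unfolding K_def by (rule compact_PiE_UNIV) auto
  moreover have "eventually (\<lambda>l. l \<in> K) (filtermap \<Lambda>\<^sub>V F)"
    unfolding eventually_filtermap
    using means
  proof eventually_elim
    case (elim e)
    interpret mean V "\<Lambda> e" by fact
    have "\<bar>\<Lambda> e f\<bar> \<le> C f" if "f \<in> V" for f using that C[OF that] by (rule I_abs_le)
    then show ?case by (auto simp: K_def \<Lambda>\<^sub>V_def abs_le_iff minus_le_iff)
  qed
  ultimately obtain L where "inf (nhds L) (filtermap \<Lambda>\<^sub>V F) \<noteq> bot"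
    using assms(1) unfolding compact_filter by (metis filtermap_bot_iff)
  then have limit: "Q L" if "closed {l. Q l}" "eventually (\<lambda>e. Q (\<Lambda>\<^sub>V e)) F" for Q
    using closed_mem_cluster_point[OF that(1), of "filtermap \<Lambda>\<^sub>V F" L] that(2)
    by (simp add: eventually_filtermap)
  have "mean V L"
  proof (rule limit)
    show "closed {L. mean V L}" using assms(2) by (rule closed_Collect_mean)
    show "eventually (\<lambda>e. mean V (\<Lambda>\<^sub>V e)) F"
      using means unfolding \<Lambda>\<^sub>V_def[abs_def] by eventually_elim (rule mean.mean_restrict)
  qed
  moreover have "c \<le> L f" if "f \<in> V" "eventually (\<lambda>e. c \<le> \<Lambda> e f) F" for f c
  proof (rule limit)
    show "closed {L. c \<le> L f}"
      by (intro closed_Collect_le continuous_intros continuous_on_product_coordinates)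
    show "eventually (\<lambda>e. c \<le> \<Lambda>\<^sub>V e f) F" using that by (simp add: \<Lambda>\<^sub>V_def)
  qed
  ultimately show ?thesis using that by blast
qed

section \<open>Finitely additive measure-preserving systems\<close>

locale mean_system = mean V I for V :: "('y \<Rightarrow> real) set" and I :: "('y \<Rightarrow> real) \<Rightarrow> real" +
  fixes S :: "'h::ab_group_add \<Rightarrow> 'y \<Rightarrow> 'y"
  assumes V_shift: "f \<in> V \<Longrightarrow> (\<lambda>y. f (S h y)) \<in> V"
    and I_shift: "f \<in> V \<Longrightarrow> I (\<lambda>y. f (S h y)) = I f"
    and S_zero: "S 0 y = y"
    and S_add: "S (a + b) y = S a (S b y)"
begin

lemma S_uminus: "S (- a) (S a y) = y" "S a (S (- a) y) = y"
  by (simp_all add: S_zero flip: S_add)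

lemma I_shift_mult:
  assumes "f \<in> V" "g \<in> V" shows "I (\<lambda>y. f (S a y) * g y) = I (\<lambda>y. f y * g (S (- a) y))"
  using I_shift[OF V_mult[OF assms(1) V_shift[OF assms(2)]], of a "- a"] by (simp add: S_uminus)

lemma norm2_shift: "f \<in> V \<Longrightarrow> norm2 (\<lambda>y. f (S h y)) = norm2 f"
  using I_shift[OF V_square, of f h] by (simp add: L2norm_def)

end

lemma mean_system_fibre_mean:
  fixes \<iota> :: "'i \<Rightarrow> 'y \<Rightarrow> 'z" and S' :: "'p::ab_group_add \<Rightarrow> 'z \<Rightarrow> 'z"
  assumes "mean_system V I S" "mean bounded_fns m"
    and fibrewise: "\<And>p i y. S' p (\<iota> i y) = \<iota> i (S (\<theta> p i) y)"
    and action: "\<And>z. S' 0 z = z" "\<And>a b z. S' (a + b) z = S' a (S' b z)"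
  shows "mean_system (fibre_fns \<iota> V) (fibre_mean \<iota> m I) S'"
proof -
  interpret mean_system V I S by fact
  interpret fibre: mean "fibre_fns \<iota> V" "fibre_mean \<iota> m I"
    using mean_axioms assms(2) by (rule mean_fibre_mean)
  show ?thesis
  proof
    fix F p assume F: "F \<in> fibre_fns \<iota> V"
    then have "(\<lambda>y. F (\<iota> i y)) \<in> V" for i by (simp add: fibre_fns_def)
    note fibre_mem = this V_shift[OF this]
    show "(\<lambda>z. F (S' p z)) \<in> fibre_fns \<iota> V"
      using F fibre_mem by (auto simp: fibre_fns_def fibrewise bounded_fns_compose)
    show "fibre_mean \<iota> m I (\<lambda>z. F (S' p z)) = fibre_mean \<iota> m I F"
      using fibre_mem I_shift[OF fibre_mem(1)] by (simp add: fibre_mean_def fibrewise)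
  qed (fact action)+
qed

subsection \<open>Invariant means\<close>

abbreviation invariant_mean :: "(('g::ab_group_add \<Rightarrow> real) \<Rightarrow> real) \<Rightarrow> bool" where
  "invariant_mean m \<equiv> mean_system bounded_fns m (\<lambda>h x. x + h)"

definition almost_invariant :: "'g::ab_group_add \<Rightarrow> real \<Rightarrow> 'g list \<Rightarrow> bool" where
  "almost_invariant g e xs \<longleftrightarrow> (\<forall>a. (\<forall>x. \<bar>a x\<bar> \<le> 1) \<longrightarrow> \<bar>avg_shift_diff xs g 0 a\<bar> \<le> e)"

lemma almost_invariant_translate:
  assumes "almost_invariant g e xs" shows "almost_invariant g e (map (\<lambda>x. x + h) xs)"
  unfolding almost_invariant_def
proof (intro allI impI)
  fix a :: "'a \<Rightarrow> real" assume "\<forall>x. \<bar>a x\<bar> \<le> 1"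
  then have "\<bar>avg_shift_diff xs g 0 (\<lambda>x. a (x + h))\<bar> \<le> e"
    using assms by (simp add: almost_invariant_def)
  then show "\<bar>avg_shift_diff (map (\<lambda>x. x + h) xs) g 0 a\<bar> \<le> e"
    by (simp add: avg_shift_diff_def avg_map add_ac)
qed

lemma almost_invariant_convolve:
  assumes "almost_invariant g e xs" "ys \<noteq> []"
  shows "almost_invariant g e (convolve xs ys)" "almost_invariant g e (convolve ys xs)"
proof -
  have "\<bar>avg_shift_diff xs (y + g) (y + 0) a\<bar> \<le> e" if "\<forall>x. \<bar>a x\<bar> \<le> 1" for a y
  proof -
    have "\<bar>avg_shift_diff xs g 0 (\<lambda>x. a (x + y))\<bar> \<le> e"
      using assms that by (simp add: almost_invariant_def)
    then show ?thesis by (simp add: avg_shift_diff_def add_ac)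
  qed
  then show "almost_invariant g e (convolve xs ys)" "almost_invariant g e (convolve ys xs)"
    unfolding almost_invariant_def
      avg_shift_diff_convolve_left[of xs ys] avg_shift_diff_convolve_right[of ys xs]
    using assms(2) by (blast intro: avg_abs_le)+
qed

lemma ex_almost_invariant:
  fixes g :: "'g::ab_group_add"
  assumes "0 < e" shows "\<exists>xs. xs \<noteq> [] \<and> almost_invariant g e xs"
proof -
  obtain n where n: "2 / e < real n" using reals_Archimedean2 by blast
  then have "0 < real n" using \<open>0 < e\<close> by (smt (verit) divide_pos_pos)
  define multiple where "multiple j = ((+) g ^^ j) 0" for j
  define xs where "xs = map multiple [0..<n]"
  have "\<bar>avg_shift_diff xs g 0 a\<bar> \<le> e" if a: "\<And>x. \<bar>a x\<bar> \<le> 1" for a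
  proof -
    have "avg_shift_diff xs g 0 a = (\<Sum>j<n. a (multiple (Suc j)) - a (multiple j)) / real n"
      by (simp add: xs_def multiple_def avg_shift_diff_def avg_map sum_subtractf diff_divide_distrib
          avg_def add.commute interv_sum_list_conv_sum_set_nat atLeast0LessThan o_def)
    also have "\<dots> = (a (multiple n) - a (multiple 0)) / real n"
      by (subst sum_lessThan_telescope) simp
    also have "\<bar>\<dots>\<bar> \<le> 2 / real n"
      using a[of "multiple n"] a[of "multiple 0"] by (auto intro!: divide_right_mono)
    also have "\<dots> \<le> e" using n \<open>0 < e\<close> \<open>0 < real n\<close> by (simp add: field_simps)
    finally show ?thesis .
  qed
  moreover have "xs \<noteq> []" using \<open>0 < real n\<close> by (simp add: xs_def)
  ultimately show ?thesis unfolding almost_invariant_def by blast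
qed

lemma ex_almost_invariant_finite:
  fixes D :: "('g::ab_group_add \<times> real) set"
  assumes "finite D" "\<And>g e. (g, e) \<in> D \<Longrightarrow> 0 < e"
  shows "\<exists>xs. xs \<noteq> [] \<and> (\<forall>(g, e)\<in>D. almost_invariant g e xs)"
  using assms
proof (induction D)
  case empty
  show ?case by (rule exI[of _ "[0]"]) simp
next
  case (insert p D)
  obtain g e where p: "p = (g, e)" by (cases p)
  obtain xs where xs: "xs \<noteq> []" "\<forall>(g, e)\<in>D. almost_invariant g e xs" using insert by blast
  obtain ys where ys: "ys \<noteq> []" "almost_invariant g e ys"
    using ex_almost_invariant[of e g] insert.prems p by blast
  show ?case
    using xs ys almost_invariant_convolve by (intro exI[of _ "convolve xs ys"]) (fastforce simp: p)
qed

text \<open>Translates of almost invariant lists are almost invariant, so \<^term>\<open>P\<close> can be imposed on lists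
  that become invariant.\<close>

lemma ex_invariance_filter:
  fixes P :: "'g::ab_group_add list \<Rightarrow> bool"
  assumes "\<And>xs. xs \<noteq> [] \<Longrightarrow> \<exists>h. P (map (\<lambda>x. x + h) xs)"
  obtains F where "F \<noteq> bot" "eventually (\<lambda>xs. xs \<noteq> [] \<and> P xs) F"
    "\<And>g e. 0 < e \<Longrightarrow> eventually (almost_invariant g e) F"
proof -
  define A where "A d = {xs. xs \<noteq> [] \<and> P xs \<and> almost_invariant (fst d) (snd d) xs}" for d :: "'g \<times> real"
  define F where "F = (INF d\<in>UNIV \<times> {0<..}. principal (A d))"
  have "(INF d\<in>D. principal (A d)) \<noteq> bot" if D: "D \<subseteq> UNIV \<times> {0<..}" "finite D" for D
  proof -
    obtain xs where xs: "xs \<noteq> []" "\<forall>(g, e)\<in>D. almost_invariant g e xs"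
      using ex_almost_invariant_finite[of D] D by fastforce
    obtain h where "P (map (\<lambda>x. x + h) xs)" using assms xs(1) by blast
    then have "map (\<lambda>x. x + h) xs \<in> A d" if "d \<in> D" for d
      using xs(1) bspec[OF xs(2) that] by (auto simp: A_def split_beta intro: almost_invariant_translate)
    then have "(\<Inter>d\<in>D. A d) \<noteq> {}" by blast
    then show ?thesis using D(2) by (simp add: INF_principal_finite principal_eq_bot_iff)
  qed
  then have "F \<noteq> bot" unfolding F_def by (rule INF_filter_not_bot)
  have A: "eventually (\<lambda>xs. xs \<in> A (g, e)) F" if "0 < e" for g e
    unfolding F_def using that by (intro eventually_INF1[of "(g, e)"]) (auto simp: eventually_principal)
  have "eventually (\<lambda>xs. xs \<noteq> [] \<and> P xs) F"
    using A[OF zero_less_one, of 0] by eventually_elim (simp add: A_def)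
  moreover have "eventually (almost_invariant g e) F" if "0 < e" for g e
    using A[OF that, of g] by eventually_elim (simp add: A_def)
  ultimately show ?thesis using that \<open>F \<noteq> bot\<close> by blast
qed

lemma mean_avg: "xs \<noteq> [] \<Longrightarrow> mean bounded_fns (\<lambda>a. avg xs (\<lambda>g. a (\<iota> g)))"
  by unfold_locales (auto simp: avg_add avg_cmult intro: avg_ge)

lemma eventually_avg_shift_diff_le:
  fixes a :: "'g::ab_group_add list \<times> 'g \<Rightarrow> real"
  assumes "a \<in> bounded_fns" "\<And>e. 0 < e \<Longrightarrow> eventually (almost_invariant h e) F" "0 < e"
  shows "eventually (\<lambda>xs. \<bar>avg_shift_diff xs h 0 (\<lambda>g. a (xs, g))\<bar> \<le> e) F"
proof -
  obtain C where C: "0 < C" "\<And>p. \<bar>a p\<bar> \<le> C" using assms(1) bounded_fnsE by blast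
  have "eventually (almost_invariant h (e / C)) F" using assms(2,3) C(1) by simp
  then show ?thesis
  proof eventually_elim
    case (elim xs)
    have "\<bar>avg_shift_diff xs h 0 (\<lambda>g. 1 / C * a (xs, g))\<bar> \<le> e / C"
      using elim C by (simp add: almost_invariant_def abs_mult)
    then show ?case unfolding avg_shift_diff_cmult using C(1) by (simp add: abs_mult divide_le_cancel)
  qed
qed

lemma mean_system_translationI:
  fixes M :: "('i \<times> 'g::ab_group_add \<Rightarrow> real) \<Rightarrow> real"
  assumes "mean bounded_fns M"
    and ge: "\<And>a h e. a \<in> bounded_fns \<Longrightarrow> 0 < e \<Longrightarrow> - e \<le> M (\<lambda>(i, g). a (i, g + h) - a (i, g))"
  shows "mean_system bounded_fns M (\<lambda>h (i, g). (i, g + h))"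
proof -
  interpret mean bounded_fns M by fact
  have shift: "(\<lambda>(i, g). a (i, g + h)) \<in> bounded_fns" if "a \<in> bounded_fns"
    for a :: "'i \<times> 'g \<Rightarrow> real" and h
    using bounded_fns_compose[OF that, of "\<lambda>(i, g). (i, g + h)"] by (simp add: case_prod_unfold)
  have shift_le: "M a \<le> M (\<lambda>(i, g). a (i, g + h))" if a: "a \<in> bounded_fns" for a h
  proof (rule field_le_epsilon)
    fix e :: real assume "0 < e"
    then show "M a \<le> M (\<lambda>(i, g). a (i, g + h)) + e"
      using ge[OF a, of e h] I_diff[OF shift[OF a, of h] a] by (simp add: case_prod_unfold)
  qed
  show ?thesis
  proof
    fix a :: "'i \<times> 'g \<Rightarrow> real" and h assume a: "a \<in> bounded_fns"
    then show "(\<lambda>p. a ((\<lambda>(i, g). (i, g + h)) p)) \<in> bounded_fns" by (rule bounded_fns_compose)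
    show "M (\<lambda>p. a ((\<lambda>(i, g). (i, g + h)) p)) = M a"
      using shift_le[OF a, of h] shift_le[OF shift[OF a, of h], of "- h"] by (simp add: case_prod_unfold)
  qed (auto simp: add_ac)
qed

lemma ex_invariant_mean_over_lists:
  fixes P :: "'g::ab_group_add list \<Rightarrow> bool"
  assumes "\<And>xs. xs \<noteq> [] \<Longrightarrow> \<exists>h. P (map (\<lambda>x. x + h) xs)"
  obtains M :: "('g list \<times> 'g \<Rightarrow> real) \<Rightarrow> real"
  where "mean_system bounded_fns M (\<lambda>h (xs, g). (xs, g + h))"
    "\<And>a c. a \<in> bounded_fns \<Longrightarrow> (\<And>xs. xs \<noteq> [] \<Longrightarrow> P xs \<Longrightarrow> c \<le> avg xs (\<lambda>g. a (xs, g))) \<Longrightarrow> c \<le> M a"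
proof -
  obtain F where "F \<noteq> bot" and F_P: "eventually (\<lambda>xs. xs \<noteq> [] \<and> P xs) F"
    and F_invariant: "\<And>g e. 0 < e \<Longrightarrow> eventually (almost_invariant g e) F"
    using ex_invariance_filter[OF assms] by blast
  have "eventually (\<lambda>xs. mean bounded_fns (\<lambda>a. avg xs (\<lambda>g. a (xs, g)))) F"
    using F_P by eventually_elim (simp add: mean_avg)
  with ex_cluster_mean[OF \<open>F \<noteq> bot\<close> bounded_fns.function_algebra_axioms,
      of "\<lambda>xs (a :: 'g list \<times> 'g \<Rightarrow> real). avg xs (\<lambda>g. a (xs, g))"]
  obtain M where "mean bounded_fns M" and M_ge: "\<And>a c. a \<in> bounded_fns \<Longrightarrow>
      eventually (\<lambda>xs. c \<le> avg xs (\<lambda>g. a (xs, g))) F \<Longrightarrow> c \<le> M a"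
    by blast
  have "mean_system bounded_fns M (\<lambda>h (xs, g). (xs, g + h))"
  proof (rule mean_system_translationI[OF \<open>mean bounded_fns M\<close>], rule M_ge)
    fix a :: "'g list \<times> 'g \<Rightarrow> real" and h and e :: real assume a: "a \<in> bounded_fns" and "0 < e"
    show "(\<lambda>(xs, g). a (xs, g + h) - a (xs, g)) \<in> bounded_fns"
      using bounded_fns.V_diff[OF bounded_fns_compose[OF a, of "\<lambda>(xs, g). (xs, g + h)"] a]
      by (simp add: case_prod_unfold)
    have "eventually (\<lambda>xs. \<bar>avg_shift_diff xs h 0 (\<lambda>g. a (xs, g))\<bar> \<le> e) F"
      using a F_invariant \<open>0 < e\<close> by (rule eventually_avg_shift_diff_le)
    then show "eventually (\<lambda>xs. - e \<le> avg xs (\<lambda>g. case (xs, g) of (xs, g) \<Rightarrow> a (xs, g + h) - a (xs, g))) F"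
      by eventually_elim (simp add: avg_shift_diff_def avg_diff)
  qed
  moreover have "c \<le> M a"
    if "a \<in> bounded_fns" "\<And>xs. xs \<noteq> [] \<Longrightarrow> P xs \<Longrightarrow> c \<le> avg xs (\<lambda>g. a (xs, g))" for a c
    using F_P by (intro M_ge[OF that(1)]) (auto elim!: eventually_mono intro: that(2))
  ultimately show ?thesis using that by blast
qed

lemma ex_invariant_mean: "\<exists>m :: ('g::ab_group_add \<Rightarrow> real) \<Rightarrow> real. invariant_mean m"
proof -
  obtain M :: "('g list \<times> 'g \<Rightarrow> real) \<Rightarrow> real"
    where "mean_system bounded_fns M (\<lambda>h (xs, g). (xs, g + h))"
    by (rule ex_invariant_mean_over_lists[of "\<lambda>_. True"]) (simp, rule that)
  then interpret mean_system bounded_fns M "\<lambda>h (xs, g). (xs, g + h)" .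
  have "invariant_mean (\<lambda>a. M (\<lambda>p. a (snd p)))"
  proof
    fix a :: "'g \<Rightarrow> real" and h assume a: "a \<in> bounded_fns"
    then show "(\<lambda>x. a (x + h)) \<in> bounded_fns" by (rule bounded_fns_compose)
    show "M (\<lambda>p. a (snd p + h)) = M (\<lambda>p. a (snd p))"
      using I_shift[OF bounded_fns_compose[OF a, of snd], of h] by (simp add: split_beta)
  qed (auto simp: I_add I_cmult I_nonneg bounded_fns_compose add_ac)
  then show ?thesis by blast
qed

section \<open>Almost convergence of multiple averages along commuting actions\<close>

definition almost_convergent ::
    "(('y \<Rightarrow> real) \<Rightarrow> real) \<Rightarrow> real \<Rightarrow> ('g::ab_group_add \<Rightarrow> 'y \<Rightarrow> real) \<Rightarrow> bool" where
  "almost_convergent I e v \<longleftrightarrow>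
    (\<exists>xs. xs \<noteq> [] \<and> (\<forall>h h'. L2norm I (\<lambda>y. avg_shift_diff xs h h' (\<lambda>g. v g y)) \<le> e))"

lemma almost_convergent_mono: "almost_convergent I a v \<Longrightarrow> a \<le> b \<Longrightarrow> almost_convergent I b v"
  unfolding almost_convergent_def by (meson order_trans)

context mean
begin

lemma almost_convergent_add:
  assumes v: "\<And>g. v g \<in> V" and w: "\<And>g. w g \<in> V"
    and "almost_convergent I a v" "almost_convergent I b w"
  shows "almost_convergent I (a + b) (\<lambda>g y. v g y + w g y)"
proof -
  obtain xs where xs: "xs \<noteq> []" "\<And>h h'. norm2 (\<lambda>y. avg_shift_diff xs h h' (\<lambda>g. v g y)) \<le> a"
    using assms(3) unfolding almost_convergent_def by blast
  obtain ys where ys: "ys \<noteq> []" "\<And>h h'. norm2 (\<lambda>y. avg_shift_diff ys h h' (\<lambda>g. w g y)) \<le> b"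
    using assms(4) unfolding almost_convergent_def by blast
  have "norm2 (\<lambda>y. avg_shift_diff (convolve xs ys) h h' (\<lambda>g. v g y + w g y)) \<le> a + b" for h h'
  proof -
    let ?v = "\<lambda>y. avg ys (\<lambda>t. avg_shift_diff xs (t + h) (t + h') (\<lambda>g. v g y))"
      and ?w = "\<lambda>y. avg xs (\<lambda>t. avg_shift_diff ys (t + h) (t + h') (\<lambda>g. w g y))"
    have "(\<lambda>y. avg_shift_diff (convolve xs ys) h h' (\<lambda>g. v g y + w g y)) = (\<lambda>y. ?v y + ?w y)"
      unfolding avg_shift_diff_add
      by (subst avg_shift_diff_convolve_left, subst avg_shift_diff_convolve_right) (rule refl)
    moreover have "norm2 (\<lambda>y. ?v y + ?w y) \<le> norm2 ?v + norm2 ?w"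
      by (intro norm2_triangle V_intros v w)
    moreover have "norm2 ?v \<le> a" by (intro norm2_avg_le ys(1) V_intros v xs(2))
    moreover have "norm2 ?w \<le> b" by (intro norm2_avg_le xs(1) V_intros w ys(2))
    ultimately show ?thesis by simp
  qed
  then show ?thesis
    unfolding almost_convergent_def using xs(1) ys(1) by (intro exI[of _ "convolve xs ys"]) simp
qed

lemma almost_convergent_cmult:
  assumes v: "\<And>g. v g \<in> V" and "almost_convergent I a v"
  shows "almost_convergent I (\<bar>c\<bar> * a) (\<lambda>g y. c * v g y)"
proof -
  obtain xs where xs: "xs \<noteq> []" "\<And>h h'. norm2 (\<lambda>y. avg_shift_diff xs h h' (\<lambda>g. v g y)) \<le> a"
    using assms(2) unfolding almost_convergent_def by blast
  then have "norm2 (\<lambda>y. avg_shift_diff xs h h' (\<lambda>g. c * v g y)) \<le> \<bar>c\<bar> * a" for h h'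
    unfolding avg_shift_diff_cmult by (simp add: norm2_cmult V_avg_shift_diff v mult_left_mono)
  then show ?thesis unfolding almost_convergent_def using xs(1) by blast
qed

lemma almost_convergent_of_small_averages:
  assumes v: "\<And>g. v g \<in> V" and "xs \<noteq> []" "\<And>h. norm2 (\<lambda>y. avg xs (\<lambda>g. v (g + h) y)) \<le> e"
  shows "almost_convergent I (2 * e) v"
proof -
  have "norm2 (\<lambda>y. avg_shift_diff xs h h' (\<lambda>g. v g y)) \<le> 2 * e" for h h'
    using norm2_triangle_diff[OF V_avg[OF v] V_avg[OF v], of xs "\<lambda>g. g + h" xs "\<lambda>g. g + h'"]
      assms(3)[of h] assms(3)[of h'] by (simp add: avg_shift_diff_def)
  then show ?thesis unfolding almost_convergent_def using assms(2) by blast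
qed

end

definition unit_ball :: "('y \<Rightarrow> real) set \<Rightarrow> ('y \<Rightarrow> real) set" where
  "unit_ball V = {f \<in> V. \<forall>y. \<bar>f y\<bar> \<le> 1}"

definition multishift ::
    "('h \<Rightarrow> 'y \<Rightarrow> 'y) \<Rightarrow> (nat \<Rightarrow> 'g \<Rightarrow> 'h) \<Rightarrow> nat \<Rightarrow> (nat \<Rightarrow> 'y \<Rightarrow> real) \<Rightarrow> 'g \<Rightarrow> 'y \<Rightarrow> real" where
  "multishift S \<phi> d f g y = (\<Prod>i<d. f i (S (\<phi> i g) y))"

context mean_system
begin

definition twisted_shift ::
    "(nat \<Rightarrow> 'g \<Rightarrow> 'h) \<Rightarrow> nat \<Rightarrow> (nat \<Rightarrow> 'y \<Rightarrow> real) \<Rightarrow> ('y \<Rightarrow> real) \<Rightarrow> 'g \<Rightarrow> 'y \<Rightarrow> real" where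
  "twisted_shift \<phi> d f u g y = multishift S \<phi> d f g y * u (S (\<phi> d g) y)"

definition structured ::
    "(nat \<Rightarrow> 'g::ab_group_add \<Rightarrow> 'h) \<Rightarrow> nat \<Rightarrow> real \<Rightarrow> ('y \<Rightarrow> real) \<Rightarrow> bool" where
  "structured \<phi> d e u \<longleftrightarrow>
    (\<forall>f \<in> {..<d} \<rightarrow> unit_ball V. almost_convergent I e (twisted_shift \<phi> d f u))"

lemma multishift_mem: "f \<in> {..<d} \<rightarrow> unit_ball V \<Longrightarrow> multishift S \<phi> d f g \<in> V"
  unfolding multishift_def[abs_def] by (intro V_prod V_shift) (auto simp: unit_ball_def Pi_iff)

lemma multishift_abs_le_1: "f \<in> {..<d} \<rightarrow> unit_ball V \<Longrightarrow> \<bar>multishift S \<phi> d f g y\<bar> \<le> 1"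
  unfolding multishift_def abs_prod by (intro prod_le_1) (auto simp: unit_ball_def Pi_iff)

lemma twisted_shift_mem: "f \<in> {..<d} \<rightarrow> unit_ball V \<Longrightarrow> u \<in> V \<Longrightarrow> twisted_shift \<phi> d f u g \<in> V"
  unfolding twisted_shift_def[abs_def] by (intro V_mult multishift_mem V_shift)

lemma twisted_shift_abs_le:
  assumes "f \<in> {..<d} \<rightarrow> unit_ball V" "\<And>y. \<bar>u y\<bar> \<le> C"
  shows "\<bar>twisted_shift \<phi> d f u g y\<bar> \<le> C"
  using mult_mono[OF multishift_abs_le_1[OF assms(1)] assms(2)]
  by (simp add: twisted_shift_def abs_mult)

lemma norm2_twisted_shift_le:
  assumes "f \<in> {..<d} \<rightarrow> unit_ball V" "u \<in> V"
  shows "norm2 (twisted_shift \<phi> d f u g) \<le> norm2 u"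
  using norm2_mult_le[OF multishift_mem V_shift multishift_abs_le_1, of f d u] norm2_shift assms
  unfolding twisted_shift_def[abs_def] by simp

lemma twisted_shift_add:
  "twisted_shift \<phi> d f (\<lambda>y. u y + v y) g y = twisted_shift \<phi> d f u g y + twisted_shift \<phi> d f v g y"
  by (simp add: twisted_shift_def distrib_left)

lemma twisted_shift_cmult: "twisted_shift \<phi> d f (\<lambda>y. c * u y) g y = c * twisted_shift \<phi> d f u g y"
  by (simp add: twisted_shift_def)

lemma structured_mono: "structured \<phi> d a u \<Longrightarrow> a \<le> b \<Longrightarrow> structured \<phi> d b u"
  unfolding structured_def using almost_convergent_mono by blast

lemma structured_add:
  assumes "u \<in> V" "v \<in> V" "structured \<phi> d a u" "structured \<phi> d b v"
  shows "structured \<phi> d (a + b) (\<lambda>y. u y + v y)"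
  using assms unfolding structured_def twisted_shift_add[abs_def]
  by (intro ballI almost_convergent_add twisted_shift_mem) auto

lemma structured_cmult:
  assumes "u \<in> V" "structured \<phi> d a u"
  shows "structured \<phi> d (\<bar>c\<bar> * a) (\<lambda>y. c * u y)"
  using assms unfolding structured_def twisted_shift_cmult[abs_def]
  by (intro ballI almost_convergent_cmult twisted_shift_mem) auto

lemma structured_zero: "structured \<phi> d 0 (\<lambda>_. 0)"
  by (auto simp: structured_def almost_convergent_def twisted_shift_def avg_shift_diff_def avg_def
      intro: exI[of _ "[0]"])

definition fibrewise_convergent :: "(nat \<Rightarrow> 'g::ab_group_add \<Rightarrow> 'h) \<Rightarrow> nat \<Rightarrow> bool" where
  "fibrewise_convergent \<phi> d \<longleftrightarrow>
    (\<forall>m (G :: 'g \<Rightarrow> nat \<Rightarrow> 'y \<Rightarrow> real) e. mean bounded_fns m \<longrightarrow> (\<forall>j. G j \<in> {..<d} \<rightarrow> unit_ball V) \<longrightarrow>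
      0 < e \<longrightarrow>
      almost_convergent (fibre_mean Pair m I) e (\<lambda>g z. multishift S \<phi> d (G (fst z)) g (snd z)))"

subsection \<open>Dual functionals of multiple averages\<close>

definition adjoint_shift ::
    "(nat \<Rightarrow> 'g \<Rightarrow> 'h) \<Rightarrow> nat \<Rightarrow> (nat \<Rightarrow> 'y \<Rightarrow> real) \<Rightarrow> ('y \<Rightarrow> real) \<Rightarrow> 'g \<Rightarrow> 'y \<Rightarrow> real" where
  "adjoint_shift \<phi> d p q g y = multishift S \<phi> d p g (S (- \<phi> d g) y) * q (S (- \<phi> d g) y)"

definition paired_fns ::
    "(nat \<Rightarrow> 'g \<Rightarrow> 'h) \<Rightarrow> nat \<Rightarrow> (nat \<Rightarrow> 'y \<Rightarrow> real) \<Rightarrow> (nat \<Rightarrow> 'y \<Rightarrow> real) \<Rightarrow> 'g \<Rightarrow> nat \<Rightarrow> 'y \<Rightarrow> real" where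
  "paired_fns \<phi> d p f g i y = p i y * f i (S (\<phi> i g - \<phi> d g) y)"

lemma adjoint_shift_mem:
  assumes "p \<in> {..<d} \<rightarrow> unit_ball V" "q \<in> V" shows "adjoint_shift \<phi> d p q g \<in> V"
  using V_shift[OF V_mult[OF multishift_mem[OF assms(1)] assms(2)]]
  by (simp add: adjoint_shift_def[abs_def])

lemma norm2_adjoint_shift_le:
  assumes "p \<in> {..<d} \<rightarrow> unit_ball V" "q \<in> V"
  shows "norm2 (adjoint_shift \<phi> d p q g) \<le> norm2 q"
  using norm2_shift[OF V_mult[OF multishift_mem[OF assms(1)] assms(2)], of \<phi> g "- \<phi> d g"]
    norm2_mult_le[OF multishift_mem[OF assms(1)] assms(2) multishift_abs_le_1[OF assms(1)], of \<phi> g]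
  by (simp add: adjoint_shift_def[abs_def])

lemma I_mult_twisted_shift:
  assumes "p \<in> {..<d} \<rightarrow> unit_ball V" "q \<in> V" "z \<in> V"
  shows "I (\<lambda>y. q y * twisted_shift \<phi> d p z g y) = I (\<lambda>y. adjoint_shift \<phi> d p q g y * z y)"
  using I_shift_mult[OF assms(3) V_mult[OF multishift_mem[OF assms(1)] assms(2)], of "\<phi> d g" \<phi> g]
  by (simp add: twisted_shift_def adjoint_shift_def mult_ac)

lemma paired_fns_mem:
  assumes "p \<in> {..<d} \<rightarrow> unit_ball V" "f \<in> {..<d} \<rightarrow> unit_ball V"
  shows "paired_fns \<phi> d p f g \<in> {..<d} \<rightarrow> unit_ball V"
  using assms unfolding paired_fns_def[abs_def]
  by (auto simp: unit_ball_def Pi_iff abs_mult intro!: V_mult V_shift mult_le_one)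

lemma twisted_adjoint_shift:
  assumes "\<And>i. Modules.additive (\<phi> i)"
  shows "twisted_shift \<phi> d f (adjoint_shift \<phi> d p q g') (g + g') (S (- \<phi> d g) y)
    = q y * multishift S \<phi> d (paired_fns \<phi> d p f g) g' y"
proof -
  note add = additive.add[OF assms]
  have "multishift S \<phi> d f (g + g') (S (- \<phi> d g) y) * multishift S \<phi> d p g' y
      = multishift S \<phi> d (paired_fns \<phi> d p f g) g' y"
    unfolding multishift_def prod.distrib[symmetric] paired_fns_def
    by (intro prod.cong) (auto simp: add algebra_simps simp flip: S_add)
  moreover have "S (- \<phi> d g') (S (\<phi> d (g + g')) (S (- \<phi> d g) y)) = y"
    by (simp add: add S_zero flip: S_add)
  ultimately show ?thesis
    by (simp add: twisted_shift_def adjoint_shift_def mult_ac)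
qed

end

lemma fibre_fnsI: "(\<And>z. \<bar>F z\<bar> \<le> C) \<Longrightarrow> (\<And>i. (\<lambda>y. F (\<iota> i y)) \<in> V) \<Longrightarrow> F \<in> fibre_fns \<iota> V"
  by (auto simp: fibre_fns_def intro: bounded_fnsI)

lemma (in mean) L2norm_fibre_mean_le:
  assumes "mean bounded_fns m" "F \<in> fibre_fns \<iota> V" "\<And>i. norm2 (\<lambda>y. F (\<iota> i y)) \<le> C" "0 \<le> C"
  shows "L2norm (fibre_mean \<iota> m I) F \<le> C"
proof -
  interpret m: mean bounded_fns m by fact
  interpret function_algebra "fibre_fns \<iota> V"
    by (rule function_algebra_fibre_fns) unfold_locales
  have "(\<lambda>i. I (\<lambda>y. (F (\<iota> i y))\<^sup>2)) \<in> bounded_fns"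
    using V_square[OF assms(2)] by (rule fibre_integral_bounded)
  then have "m (\<lambda>i. I (\<lambda>y. (F (\<iota> i y))\<^sup>2)) \<le> C\<^sup>2"
  proof (rule m.I_le)
    fix i
    have F: "(\<lambda>y. F (\<iota> i y)) \<in> V" using assms(2) by (simp add: fibre_fns_def)
    show "I (\<lambda>y. (F (\<iota> i y))\<^sup>2) \<le> C\<^sup>2"
      using assms(3)[of i] norm2_nonneg[OF F] unfolding norm2_square[OF F, symmetric] by (rule power_mono)
  qed
  with \<open>0 \<le> C\<close> show ?thesis
    unfolding L2norm_def fibre_mean_def by (rule real_le_lsqrt)
qed

text \<open>In the application \<open>w\<close> assigns to a list the twisted average along it, and \<open>M\<close> averages along the
  list, in the limit of almost invariant lists.\<close>

locale dual_functional = mean_system V I S + M: mean_system bounded_fns M "\<lambda>h (i, g). (i, g + h)"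
  for V I and S :: "'h::ab_group_add \<Rightarrow> 'y \<Rightarrow> 'y"
    and M :: "('e \<times> 'g::ab_group_add \<Rightarrow> real) \<Rightarrow> real" +
  fixes \<phi> :: "nat \<Rightarrow> 'g \<Rightarrow> 'h" and d :: nat and f :: "nat \<Rightarrow> 'y \<Rightarrow> real"
    and w :: "'e \<Rightarrow> 'y \<Rightarrow> real" and B :: real
  assumes additive: "\<And>i. Modules.additive (\<phi> i)"
    and f: "f \<in> {..<d} \<rightarrow> unit_ball V"
    and w: "w i \<in> V" and w_le: "\<bar>w i y\<bar> \<le> B"
begin

sublocale N: mean "fibre_fns Pair V" "fibre_mean Pair M I"
  using mean_axioms M.mean_axioms by (rule mean_fibre_mean)

definition base :: "('e \<times> 'g) \<times> 'y \<Rightarrow> real" where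
  "base z = w (fst (fst z)) (snd z)"

definition twist :: "('y \<Rightarrow> real) \<Rightarrow> ('e \<times> 'g) \<times> 'y \<Rightarrow> real" where
  "twist q z = twisted_shift \<phi> d f q (snd (fst z)) (snd z)"

definition dual :: "('y \<Rightarrow> real) \<Rightarrow> real" where
  "dual q = fibre_mean Pair M I (\<lambda>z. base z * twist q z)"

lemma base_mem: "base \<in> fibre_fns Pair V"
  by (rule fibre_fnsI[of _ B]) (auto simp: base_def w w_le)

lemma twist_mem: assumes "q \<in> V" shows "twist q \<in> fibre_fns Pair V"
proof -
  obtain C where "0 < C" "\<And>y. \<bar>q y\<bar> \<le> C" using V_boundE[OF assms] by blast
  then show ?thesis
    using assms f
    by (intro fibre_fnsI[of _ C]) (auto simp: twist_def twisted_shift_mem twisted_shift_abs_le)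
qed

lemma dual_add: "u \<in> V \<Longrightarrow> v \<in> V \<Longrightarrow> dual (\<lambda>y. u y + v y) = dual u + dual v"
  unfolding dual_def twist_def twisted_shift_add distrib_left
  by (fold twist_def) (intro N.I_add N.V_mult base_mem twist_mem)

lemma dual_cmult: "u \<in> V \<Longrightarrow> dual (\<lambda>y. c * u y) = c * dual u"
  unfolding dual_def twist_def twisted_shift_cmult mult.left_commute[of _ c]
  by (fold twist_def) (intro N.I_cmult N.V_mult base_mem twist_mem)

lemma dual_abs_le:
  assumes "\<And>i. norm2 (w i) \<le> C" "q \<in> V" shows "\<bar>dual q\<bar> \<le> C * norm2 q"
proof -
  have "0 \<le> C" using assms(1) norm2_nonneg[OF w] order_trans by blast
  have "\<bar>dual q\<bar> \<le> N.norm2 base * N.norm2 (twist q)"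
    unfolding dual_def by (intro N.Cauchy_Schwarz base_mem twist_mem assms(2))
  also have "\<dots> \<le> C * norm2 q"
    using \<open>0 \<le> C\<close> assms f norm2_twisted_shift_le
    by (intro mult_mono L2norm_fibre_mean_le M.mean_axioms base_mem twist_mem norm2_nonneg N.norm2_nonneg)
       (auto simp: base_def twist_def)
  finally show ?thesis .
qed

definition shifted_base :: "('y \<Rightarrow> real) \<Rightarrow> ('e \<times> 'g) \<times> 'y \<Rightarrow> real" where
  "shifted_base q z = w (fst (fst z)) (S (- \<phi> d (snd (fst z))) (snd z)) * q (snd z)"

definition paired_shift :: "(nat \<Rightarrow> 'y \<Rightarrow> real) \<Rightarrow> 'g \<Rightarrow> ('e \<times> 'g) \<times> 'y \<Rightarrow> real" where
  "paired_shift p g z = multishift S \<phi> d (paired_fns \<phi> d p f (snd (fst z))) g (snd z)"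

text \<open>Substituting \<open>g + g'\<close> for the averaging variable \<open>g\<close> removes the shift of the last function.\<close>

lemma dual_adjoint_shift:
  assumes p: "p \<in> {..<d} \<rightarrow> unit_ball V" and q: "q \<in> V"
  shows "dual (adjoint_shift \<phi> d p q g')
    = fibre_mean Pair M I (\<lambda>z. shifted_base q z * paired_shift p g' z)"
proof -
  let ?q = "adjoint_shift \<phi> d p q g'"
  have mem: "?q \<in> V" using p q by (rule adjoint_shift_mem)
  define a where "a i g = I (\<lambda>y. w i y * twisted_shift \<phi> d f ?q g y)" for i g
  have "(\<lambda>(i, g). a i g) \<in> bounded_fns"
    using fibre_integral_bounded[OF N.V_mult[OF base_mem twist_mem[OF mem]]]
    by (simp add: a_def base_def twist_def case_prod_unfold)
  then have "dual ?q = M (\<lambda>(i, g). a i (g + g'))"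
    using M.I_shift[of "\<lambda>(i, g). a i g" g']
    by (simp add: dual_def fibre_mean_def a_def base_def twist_def case_prod_unfold)
  moreover have "a i (g + g')
      = I (\<lambda>y. w i (S (- \<phi> d g) y) * q y * multishift S \<phi> d (paired_fns \<phi> d p f g) g' y)" for i g
  proof -
    have "a i (g + g')
        = I (\<lambda>y. w i (S (- \<phi> d g) y) * twisted_shift \<phi> d f ?q (g + g') (S (- \<phi> d g) y))"
      unfolding a_def by (rule I_shift[symmetric]) (intro V_mult w twisted_shift_mem f mem)
    then show ?thesis by (simp add: twisted_adjoint_shift additive mult.assoc)
  qed
  ultimately show ?thesis
    by (simp add: fibre_mean_def shifted_base_def paired_shift_def case_prod_unfold)
qed

lemma shifted_base_mem: assumes "q \<in> V" shows "shifted_base q \<in> fibre_fns Pair V"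
proof -
  obtain C where C: "0 < C" "\<And>y. \<bar>q y\<bar> \<le> C" using V_boundE[OF assms] by blast
  have "\<bar>shifted_base q z\<bar> \<le> B * C" for z
    unfolding shifted_base_def abs_mult using w_le[THEN order_trans[OF abs_ge_zero]]
    by (intro mult_mono w_le C(2)) auto
  then show ?thesis by (rule fibre_fnsI) (auto simp: shifted_base_def intro!: V_mult V_shift w assms)
qed

lemma paired_shift_mem:
  assumes "p \<in> {..<d} \<rightarrow> unit_ball V" shows "paired_shift p g \<in> fibre_fns Pair V"
  using multishift_mem[OF paired_fns_mem[OF assms f]] multishift_abs_le_1[OF paired_fns_mem[OF assms f]]
  by (intro fibre_fnsI[of _ 1]) (auto simp: paired_shift_def)

lemma avg_shift_diff_dual_le:
  assumes p: "p \<in> {..<d} \<rightarrow> unit_ball V" and q: "q \<in> V"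
    and small: "N.norm2 (\<lambda>z. avg_shift_diff xs h h' (\<lambda>g. paired_shift p g z)) \<le> \<delta>"
  shows "avg_shift_diff xs h h' (\<lambda>g. dual (adjoint_shift \<phi> d p q g)) \<le> B * norm2 q * \<delta>"
proof -
  let ?D = "\<lambda>z. avg_shift_diff xs h h' (\<lambda>g. paired_shift p g z)"
  have D: "?D \<in> fibre_fns Pair V" by (intro N.V_avg_shift_diff paired_shift_mem p)
  have "0 \<le> B" using w_le abs_ge_zero order_trans by blast
  have "avg_shift_diff xs h h' (\<lambda>g. dual (adjoint_shift \<phi> d p q g))
      = fibre_mean Pair M I (\<lambda>z. avg_shift_diff xs h h' (\<lambda>g. shifted_base q z * paired_shift p g z))"
    unfolding dual_adjoint_shift[OF p q]
    by (intro N.I_avg_shift_diff[symmetric] N.V_mult shifted_base_mem paired_shift_mem p q)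
  also have "\<dots> \<le> N.norm2 (shifted_base q) * N.norm2 ?D"
    unfolding avg_shift_diff_cmult by (intro N.I_mult_le shifted_base_mem q D)
  also have "\<dots> \<le> B * norm2 q * \<delta>"
  proof (intro mult_mono small N.norm2_nonneg D)
    show "N.norm2 (shifted_base q) \<le> B * norm2 q"
      using \<open>0 \<le> B\<close> q
      by (intro L2norm_fibre_mean_le M.mean_axioms shifted_base_mem mult_nonneg_nonneg norm2_nonneg)
         (auto simp: shifted_base_def intro!: norm2_mult_le V_shift w w_le)
  qed (use \<open>0 \<le> B\<close> norm2_nonneg[OF q] in auto)
  finally show ?thesis .
qed

lemma paired_shift_almost_convergent:
  assumes p: "p \<in> {..<d} \<rightarrow> unit_ball V" and "fibrewise_convergent \<phi> d" "0 < \<delta>"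
  shows "almost_convergent (fibre_mean Pair M I) \<delta> (paired_shift p)"
proof -
  interpret marginal: mean bounded_fns "\<lambda>a. M (\<lambda>i. a (snd i))"
    by unfold_locales (auto simp: M.I_add M.I_cmult M.I_nonneg bounded_fns_compose)
  have "almost_convergent (fibre_mean Pair (\<lambda>a. M (\<lambda>i. a (snd i))) I) \<delta>
      (\<lambda>g z. multishift S \<phi> d (paired_fns \<phi> d p f (fst z)) g (snd z))"
    using \<open>0 < \<delta>\<close>
    by (intro assms(2)[unfolded fibrewise_convergent_def, rule_format] marginal.mean_axioms
        paired_fns_mem p f)
  then show ?thesis
    by (simp add: almost_convergent_def L2norm_def fibre_mean_def paired_shift_def)
qed

lemma structured_if_represents_dual:
  assumes z: "z \<in> V" and represents: "\<And>q. q \<in> V \<Longrightarrow> \<bar>dual q - I (\<lambda>y. q y * z y)\<bar> \<le> e / 4 * norm2 q"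
    and "fibrewise_convergent \<phi> d" "0 < e" "0 < B"
  shows "structured \<phi> d e z"
  unfolding structured_def
proof
  fix p assume p: "p \<in> {..<d} \<rightarrow> unit_ball V"
  have "0 < e / (2 * B)" using \<open>0 < e\<close> \<open>0 < B\<close> by simp
  then obtain xs where "xs \<noteq> []"
    and small: "\<And>h h'. N.norm2 (\<lambda>z. avg_shift_diff xs h h' (\<lambda>g. paired_shift p g z)) \<le> e / (2 * B)"
    using paired_shift_almost_convergent[OF p assms(3)] unfolding almost_convergent_def by blast
  have "norm2 (\<lambda>y. avg_shift_diff xs h h' (\<lambda>g. twisted_shift \<phi> d p z g y)) \<le> e" for h h'
  proof (rule norm2_leI)
    let ?q = "\<lambda>y. avg_shift_diff xs h h' (\<lambda>g. twisted_shift \<phi> d p z g y)"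
    let ?a = "\<lambda>g. adjoint_shift \<phi> d p ?q g"
    show q: "?q \<in> V" by (intro V_avg_shift_diff twisted_shift_mem p z)
    note adjoint = adjoint_shift_mem[OF p q] norm2_adjoint_shift_le[OF p q]
    have "I (\<lambda>y. ?q y * ?q y) = avg_shift_diff xs h h' (\<lambda>g. I (\<lambda>y. ?a g y * z y))"
      unfolding avg_shift_diff_cmult[symmetric] I_mult_twisted_shift[OF p q z, symmetric]
      by (intro I_avg_shift_diff V_mult q twisted_shift_mem p z)
    also have "\<dots> = avg_shift_diff xs h h' (\<lambda>g. dual (?a g))
        + avg_shift_diff xs h h' (\<lambda>g. I (\<lambda>y. ?a g y * z y) - dual (?a g))"
      by (simp flip: avg_shift_diff_add)
    also have "\<dots> \<le> B * norm2 ?q * (e / (2 * B)) + 2 * (e / 4 * norm2 ?q)"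
    proof (intro add_mono avg_shift_diff_dual_le p q small abs_le_D1[OF avg_shift_diff_abs_le] \<open>xs \<noteq> []\<close>)
      fix g
      have "\<bar>dual (?a g) - I (\<lambda>y. ?a g y * z y)\<bar> \<le> e / 4 * norm2 (?a g)" by (intro represents adjoint)
      also have "\<dots> \<le> e / 4 * norm2 ?q" using \<open>0 < e\<close> by (intro mult_left_mono adjoint) auto
      finally show "\<bar>I (\<lambda>y. ?a g y * z y) - dual (?a g)\<bar> \<le> e / 4 * norm2 ?q"
        by (simp add: abs_minus_commute)
    qed
    also have "\<dots> = e * norm2 ?q" using \<open>0 < B\<close> by (simp add: field_simps)
    finally show "I (\<lambda>y. ?q y * ?q y) \<le> e * norm2 ?q" .
  qed (use \<open>0 < e\<close> in simp)
  then show "almost_convergent I e (twisted_shift \<phi> d p z)"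
    unfolding almost_convergent_def using \<open>xs \<noteq> []\<close> by blast
qed

lemma ex_structured_representative:
  assumes w_le: "\<And>i. norm2 (w i) \<le> C" and "fibrewise_convergent \<phi> d" "0 < e" "0 < B" "0 \<le> C"
  obtains z where "z \<in> V" "structured \<phi> d e z" "norm2 z \<le> C + e"
    "\<And>q. q \<in> V \<Longrightarrow> dual q - e * norm2 q \<le> I (\<lambda>y. q y * z y)"
proof -
  have "0 < e / 4" using \<open>0 < e\<close> by simp
  note dual_le = dual_abs_le[OF w_le]
  obtain z where z: "z \<in> V" "\<And>q. q \<in> V \<Longrightarrow> \<bar>dual q - I (\<lambda>y. q y * z y)\<bar> \<le> e / 4 * norm2 q"
    using approximate_Riesz[of dual C "e / 4", OF dual_add dual_cmult dual_le \<open>0 < e / 4\<close>] by blast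
  have "structured \<phi> d e z"
    using z assms(2-4) by (rule structured_if_represents_dual)
  moreover have "norm2 z \<le> C + e / 4"
    using z(1) dual_le[OF z(1)] z(2)[OF z(1)]
    by (rule norm2_Riesz_representative_le) (use \<open>0 \<le> C\<close> \<open>0 < e\<close> in simp)
  moreover have "dual q - e * norm2 q \<le> I (\<lambda>y. q y * z y)" if "q \<in> V" for q
  proof -
    have "e / 4 * norm2 q \<le> e * norm2 q"
      using \<open>0 < e\<close> norm2_nonneg[OF that] by (intro mult_right_mono) auto
    then show ?thesis using z(2)[OF that] by linarith
  qed
  ultimately show ?thesis using that[OF z(1)] \<open>0 < e\<close> by simp
qed

end

subsection \<open>Walsh's theorem\<close>

context mean_system
begin

definition twisted_average ::
    "(nat \<Rightarrow> 'g \<Rightarrow> 'h) \<Rightarrow> nat \<Rightarrow> (nat \<Rightarrow> 'y \<Rightarrow> real) \<Rightarrow> ('y \<Rightarrow> real) \<Rightarrow> 'g list \<Rightarrow> 'y \<Rightarrow> real" where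
  "twisted_average \<phi> d f u xs y = avg xs (\<lambda>g. twisted_shift \<phi> d f u g y)"

lemma twisted_average_Nil [simp]: "twisted_average \<phi> d f u [] = (\<lambda>_. 0)"
  by (simp add: twisted_average_def[abs_def] avg_def)

lemma twisted_average_mem:
  "f \<in> {..<d} \<rightarrow> unit_ball V \<Longrightarrow> u \<in> V \<Longrightarrow> twisted_average \<phi> d f u xs \<in> V"
  unfolding twisted_average_def[abs_def] by (intro V_avg twisted_shift_mem)

lemma twisted_average_abs_le:
  assumes "f \<in> {..<d} \<rightarrow> unit_ball V" "\<And>y. \<bar>u y\<bar> \<le> B"
  shows "\<bar>twisted_average \<phi> d f u xs y\<bar> \<le> B"
proof (cases "xs = []")
  case True
  then show ?thesis using assms(2)[THEN order_trans[OF abs_ge_zero]] by simp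
next
  case False
  then show ?thesis
    unfolding twisted_average_def by (intro avg_abs_le twisted_shift_abs_le assms)
qed

lemma norm2_twisted_average_le:
  assumes "f \<in> {..<d} \<rightarrow> unit_ball V" "u \<in> V"
  shows "norm2 (twisted_average \<phi> d f u xs) \<le> norm2 u"
proof (cases "xs = []")
  case True
  then show ?thesis using norm2_nonneg[OF assms(2)] by simp
next
  case False
  then show ?thesis
    unfolding twisted_average_def[abs_def]
    by (intro norm2_avg_le twisted_shift_mem norm2_twisted_shift_le assms)
qed

lemma avg_I_twisted_average:
  assumes "f \<in> {..<d} \<rightarrow> unit_ball V" "u \<in> V"
  shows "avg xs (\<lambda>g. I (\<lambda>y. twisted_average \<phi> d f u xs y * twisted_shift \<phi> d f u g y))
    = (norm2 (twisted_average \<phi> d f u xs))\<^sup>2"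
proof -
  have "avg xs (\<lambda>g. I (\<lambda>y. twisted_average \<phi> d f u xs y * twisted_shift \<phi> d f u g y))
      = I (\<lambda>y. avg xs (\<lambda>g. twisted_average \<phi> d f u xs y * twisted_shift \<phi> d f u g y))"
    by (intro I_avg[symmetric] V_mult twisted_average_mem twisted_shift_mem assms)
  then show ?thesis
    unfolding norm2_square[OF twisted_average_mem[OF assms]]
    by (simp add: avg_cmult power2_eq_square flip: twisted_average_def)
qed

lemma ex_large_twisted_average:
  assumes "u \<in> V" "\<not> structured \<phi> d (2 * \<eta>) u"
  obtains f where "f \<in> {..<d} \<rightarrow> unit_ball V"
    "\<And>xs. xs \<noteq> [] \<Longrightarrow> \<exists>h. \<eta> < norm2 (twisted_average \<phi> d f u (map (\<lambda>x. x + h) xs))"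
proof -
  obtain f where f: "f \<in> {..<d} \<rightarrow> unit_ball V"
    and not_convergent: "\<not> almost_convergent I (2 * \<eta>) (twisted_shift \<phi> d f u)"
    using assms(2) by (auto simp: structured_def)
  have "\<exists>h. \<eta> < norm2 (twisted_average \<phi> d f u (map (\<lambda>x. x + h) xs))" if "xs \<noteq> []" for xs
  proof (rule ccontr)
    assume "\<not> ?thesis"
    then have "norm2 (\<lambda>y. avg xs (\<lambda>g. twisted_shift \<phi> d f u (g + h) y)) \<le> \<eta>" for h
      by (simp add: twisted_average_def[abs_def] avg_map not_less)
    then show False
      using almost_convergent_of_small_averages[of "twisted_shift \<phi> d f u",
          OF twisted_shift_mem[OF f assms(1)] that] not_convergent by blast
  qed
  then show ?thesis using that f by blast
qed

lemma ex_structured_correlate: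
  fixes \<phi> :: "nat \<Rightarrow> 'g::ab_group_add \<Rightarrow> 'h"
  assumes additive: "\<And>i. Modules.additive (\<phi> i)" and "fibrewise_convergent \<phi> d"
    and r: "r \<in> V" "\<not> structured \<phi> d (2 * \<eta>) r" and "0 < \<eta>" "0 < e"
  shows "\<exists>z\<in>V. structured \<phi> d e z \<and> norm2 z \<le> norm2 r + e \<and> \<eta>\<^sup>2 - e * norm2 r \<le> I (\<lambda>y. r y * z y)"
proof -
  obtain f where f: "f \<in> {..<d} \<rightarrow> unit_ball V"
    and large: "\<And>xs. xs \<noteq> [] \<Longrightarrow> \<exists>h. \<eta> < norm2 (twisted_average \<phi> d f r (map (\<lambda>x. x + h) xs))"
    using ex_large_twisted_average[OF r] by blast
  obtain M :: "('g list \<times> 'g \<Rightarrow> real) \<Rightarrow> real"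
    where M: "mean_system bounded_fns M (\<lambda>h (xs, g). (xs, g + h))"
      and M_ge: "\<And>a c. a \<in> bounded_fns \<Longrightarrow>
        (\<And>xs. xs \<noteq> [] \<Longrightarrow> \<eta> < norm2 (twisted_average \<phi> d f r xs) \<Longrightarrow> c \<le> avg xs (\<lambda>g. a (xs, g))) \<Longrightarrow>
        c \<le> M a"
    using ex_invariant_mean_over_lists[of "\<lambda>xs. \<eta> < norm2 (twisted_average \<phi> d f r xs)", OF large] by blast
  interpret M: mean_system bounded_fns M "\<lambda>h (xs, g). (xs, g + h)" by fact
  obtain B where B: "0 < B" "\<And>y. \<bar>r y\<bar> \<le> B" using V_boundE[OF r(1)] by blast
  interpret dual_functional V I S M \<phi> d f "twisted_average \<phi> d f r" B
    by (intro dual_functional.intro dual_functional_axioms.intro mean_system_axioms M additive f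
        twisted_average_mem twisted_average_abs_le r(1) B(2))
  have "\<eta>\<^sup>2 \<le> dual r"
    unfolding dual_def fibre_mean_def
  proof (rule M_ge[OF fibre_integral_bounded[OF N.V_mult[OF base_mem twist_mem[OF r(1)]]]])
    fix xs :: "'g list" assume "\<eta> < norm2 (twisted_average \<phi> d f r xs)"
    then have "\<eta>\<^sup>2 \<le> (norm2 (twisted_average \<phi> d f r xs))\<^sup>2" using \<open>0 < \<eta>\<close> by (intro power_mono) auto
    then show "\<eta>\<^sup>2 \<le> avg xs (\<lambda>g. I (\<lambda>y. base ((xs, g), y) * twist r ((xs, g), y)))"
      by (simp add: base_def twist_def avg_I_twisted_average f r(1))
  qed
  obtain z where z: "z \<in> V" "structured \<phi> d e z" "norm2 z \<le> norm2 r + e"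
    and dual_le: "\<And>q. q \<in> V \<Longrightarrow> dual q - e * norm2 q \<le> I (\<lambda>y. q y * z y)"
    using ex_structured_representative[OF norm2_twisted_average_le[OF f r(1)] assms(2) \<open>0 < e\<close> B(1)
        norm2_nonneg[OF r(1)]] by blast
  have "\<eta>\<^sup>2 - e * norm2 r \<le> I (\<lambda>y. r y * z y)"
    using \<open>\<eta>\<^sup>2 \<le> dual r\<close> dual_le[OF r(1)] by linarith
  with z show ?thesis by blast
qed

lemma all_structured:
  fixes \<phi> :: "nat \<Rightarrow> 'g::ab_group_add \<Rightarrow> 'h"
  assumes "\<And>i. Modules.additive (\<phi> i)" "fibrewise_convergent \<phi> d" "u \<in> V" "0 < e"
  shows "structured \<phi> d e u"
proof -
  define \<eta> where "\<eta> = e / 4"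
  define C where "C = norm2 u + 1"
  have pos: "0 < \<eta>" "0 < C"
    using \<open>0 < e\<close> norm2_nonneg[OF \<open>u \<in> V\<close>] by (auto simp: \<eta>_def C_def add_nonneg_pos)
  show ?thesis
  proof (rule energy_decrement[where P = "structured \<phi> d" and C = C and \<delta> = "\<eta>\<^sup>2 / 2"])
    fix r and a :: real
    assume r: "r \<in> V" "norm2 r \<le> norm2 u" "\<not> structured \<phi> d (e / 2) r" and "0 < a"
    define b where "b = min a (min 1 (\<eta>\<^sup>2 / 2 / C))"
    have b: "0 < b" "b \<le> a" "b \<le> 1" "b \<le> \<eta>\<^sup>2 / 2 / C" using \<open>0 < a\<close> pos by (auto simp: b_def)
    have "\<not> structured \<phi> d (2 * \<eta>) r" using r(3) by (simp add: \<eta>_def)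
    then obtain z where z: "z \<in> V" "structured \<phi> d b z" "norm2 z \<le> norm2 r + b"
      "\<eta>\<^sup>2 - b * norm2 r \<le> I (\<lambda>y. r y * z y)"
      using ex_structured_correlate[OF assms(1,2) r(1) _ pos(1) b(1)] by blast
    have "b * norm2 r \<le> \<eta>\<^sup>2 / 2 / C * C"
      using b pos r norm2_nonneg[OF r(1)] by (intro mult_mono) (auto simp: C_def)
    then have "\<eta>\<^sup>2 / 2 \<le> I (\<lambda>y. r y * z y)" using z(4) pos by simp
    moreover have "norm2 z \<le> C" using z(3) r(2) b(3) by (simp add: C_def)
    ultimately show "\<exists>z\<in>V. structured \<phi> d a z \<and> norm2 z \<le> C \<and> \<eta>\<^sup>2 / 2 \<le> I (\<lambda>y. r y * z y)"
      using z(1,2) structured_mono b(2) by blast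
  qed (use assms(3,4) pos in \<open>auto intro: structured_add structured_cmult structured_mono structured_zero\<close>)
qed

lemma fibrewise_convergentI:
  fixes push :: "'g::ab_group_add \<Rightarrow> 'y \<Rightarrow> 'y" and \<phi> :: "nat \<Rightarrow> 'g \<Rightarrow> 'h"
  assumes inj: "inj (\<lambda>(g, y). push g y)" and S_push: "\<And>h g y. S h (push g y) = push g (S h y)"
    and convergent: "\<And>V' I' f e. mean_system V' I' S \<Longrightarrow> f \<in> {..<d} \<rightarrow> unit_ball V' \<Longrightarrow> 0 < e \<Longrightarrow>
      almost_convergent I' e (multishift S \<phi> d f)"
  shows "fibrewise_convergent \<phi> d"
  unfolding fibrewise_convergent_def
proof (intro allI impI)
  fix m :: "('g \<Rightarrow> real) \<Rightarrow> real" and G :: "'g \<Rightarrow> nat \<Rightarrow> 'y \<Rightarrow> real" and e :: real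
  assume m: "mean bounded_fns m" and G: "\<forall>j. G j \<in> {..<d} \<rightarrow> unit_ball V" and "0 < e"
  define F where "F i p = (case inv (\<lambda>(g, y). push g y) p of (g, y) \<Rightarrow> G g i y)" for i p
  have F_push: "F i (push g y) = G g i y" for i g y
    using inv_f_f[OF inj, of "(g, y)"] by (simp add: F_def)
  have "F \<in> {..<d} \<rightarrow> unit_ball (fibre_fns push V)"
  proof
    fix i assume "i \<in> {..<d}"
    then have G_i: "G g i \<in> V" "\<bar>G g i y\<bar> \<le> 1" for g y using G by (auto simp: unit_ball_def Pi_iff)
    then have "\<bar>F i p\<bar> \<le> 1" for p by (simp add: F_def split_beta)
    with G_i(1) show "F i \<in> unit_ball (fibre_fns push V)"
      by (auto simp: unit_ball_def F_push intro!: fibre_fnsI[of _ 1])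
  qed
  moreover have "mean_system (fibre_fns push V) (fibre_mean push m I) S"
    using mean_system_axioms m
    by (rule mean_system_fibre_mean[where \<theta> = "\<lambda>p _. p"]) (simp_all add: S_push S_zero S_add)
  ultimately have "almost_convergent (fibre_mean push m I) e (multishift S \<phi> d F)"
    using \<open>0 < e\<close> convergent by blast
  moreover have "multishift S \<phi> d F g' (push g y) = multishift S \<phi> d (G g) g' y" for g' g y
    by (simp add: multishift_def S_push F_push)
  ultimately show "almost_convergent (fibre_mean Pair m I) e
      (\<lambda>g z. multishift S \<phi> d (G (fst z)) g (snd z))"
    by (simp add: almost_convergent_def L2norm_def fibre_mean_def)
qed

end

text \<open>The induction passes to systems fibred over the averaging group; \<^term>\<open>push\<close> keeps these
  on the same type.\<close>

lemma multishift_almost_convergent_push: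
  fixes push :: "'g::ab_group_add \<Rightarrow> 'y \<Rightarrow> 'y" and \<phi> :: "nat \<Rightarrow> 'g \<Rightarrow> 'h::ab_group_add"
  assumes push: "inj (\<lambda>(g, y). push g y)" "\<And>h g y. S h (push g y) = push g (S h y)"
    and additive: "\<And>i. Modules.additive (\<phi> i)"
    and "mean_system V I S" "f \<in> {..<d} \<rightarrow> unit_ball V" "0 < e"
  shows "almost_convergent I e (multishift S \<phi> d f)"
  using assms(4-)
proof (induction d arbitrary: V I f e)
  case 0
  interpret mean_system V I S by fact
  show ?case
    using \<open>0 < e\<close>
    by (auto simp: almost_convergent_def multishift_def avg_shift_diff_def intro!: exI[of _ "[0]"])
next
  case (Suc d)
  interpret mean_system V I S by fact
  have "fibrewise_convergent \<phi> d" using push Suc.IH by (rule fibrewise_convergentI)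
  then have "structured \<phi> d e (f d)"
    using Suc.prems additive by (intro all_structured) (auto simp: unit_ball_def Pi_iff)
  moreover have "f \<in> {..<d} \<rightarrow> unit_ball V" using Suc.prems(2) by auto
  ultimately have "almost_convergent I e (twisted_shift \<phi> d f (f d))" by (simp add: structured_def)
  then show ?case by (simp add: twisted_shift_def[abs_def] multishift_def[abs_def])
qed

context mean_system
begin

lemma multishift_almost_convergent:
  fixes \<phi> :: "nat \<Rightarrow> 'g::ab_group_add \<Rightarrow> 'h"
  assumes "\<And>i. Modules.additive (\<phi> i)" "f \<in> {..<d} \<rightarrow> unit_ball V" "0 < e"
  shows "almost_convergent I e (multishift S \<phi> d f)"
proof -
  let ?\<iota> = "\<lambda>(_ :: unit) y. ([] :: 'g list, y)"
  let ?V = "fibre_fns ?\<iota> V" and ?I = "fibre_mean ?\<iota> (\<lambda>a. a ()) I"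
  let ?S = "\<lambda>h (gs :: 'g list, y). (gs, S h y)"
  have "mean bounded_fns (\<lambda>a :: unit \<Rightarrow> real. a ())" by unfold_locales auto
  then have "mean_system ?V ?I ?S"
    by (rule mean_system_fibre_mean[OF mean_system_axioms, where \<theta> = "\<lambda>h _. h"]) (auto simp: S_zero S_add)
  moreover have "(\<lambda>i p. f i (snd p)) \<in> {..<d} \<rightarrow> unit_ball ?V"
    using assms(2) by (auto simp: unit_ball_def Pi_iff intro!: fibre_fnsI[of _ 1])
  ultimately have "almost_convergent ?I e (multishift ?S \<phi> d (\<lambda>i p. f i (snd p)))"
    using assms(1,3)
    by (intro multishift_almost_convergent_push[where push = "\<lambda>g (gs, y). (g # gs, y)"])
      (auto simp: inj_def)
  then show ?thesis
    by (simp add: almost_convergent_def L2norm_def fibre_mean_def multishift_def)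
qed

lemma ex_scaled_in_unit_ball:
  assumes "f \<in> V" obtains C where "0 < C" "(\<lambda>y. f y / C) \<in> unit_ball V"
proof -
  obtain C where C: "0 < C" "\<And>y. \<bar>f y\<bar> \<le> C" using V_boundE[OF assms] by blast
  have "(\<lambda>y. f y / C) \<in> V" using V_cmult[OF assms, of "1 / C"] by simp
  then show ?thesis using that C by (simp add: unit_ball_def abs_mult)
qed

lemma unit_correlations_almost_convergent:
  fixes \<phi> :: "'j \<Rightarrow> 'g::ab_group_add \<Rightarrow> 'h"
  assumes "finite J" and additive: "\<And>j. j \<in> J \<Longrightarrow> Modules.additive (\<phi> j)"
    and f: "\<And>j. j \<in> J \<Longrightarrow> f j \<in> unit_ball V" and "0 < e"
  obtains xs where "xs \<noteq> []"
    "\<And>h h'. \<bar>avg_shift_diff xs h h' (\<lambda>g. I (\<lambda>y. \<Prod>j\<in>J. f j (S (\<phi> j g) y)))\<bar> \<le> e"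
proof -
  obtain b where b: "bij_betw b {..<card J} J"
    using ex_bij_betw_nat_finite[OF \<open>finite J\<close>] by (auto simp: atLeast0LessThan)
  have b_mem: "b i \<in> J" if "i < card J" for i using bij_betwE[OF b] that by blast
  define \<psi> where "\<psi> i = (if i < card J then \<phi> (b i) else (\<lambda>_. 0))" for i
  let ?p = "multishift S \<psi> (card J) (\<lambda>i. f (b i))"
  have unit: "(\<lambda>i. f (b i)) \<in> {..<card J} \<rightarrow> unit_ball V" using f b_mem by auto
  have "Modules.additive (\<psi> i)" for i
    using additive b_mem by (auto simp: \<psi>_def Modules.additive_def)
  then obtain xs where xs: "xs \<noteq> []"
    "\<And>h h'. norm2 (\<lambda>y. avg_shift_diff xs h h' (\<lambda>g. ?p g y)) \<le> e"
    using multishift_almost_convergent[of \<psi>, OF _ unit \<open>0 < e\<close>] unfolding almost_convergent_def by blast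
  have "(\<Prod>j\<in>J. f j (S (\<phi> j g) y)) = ?p g y" for g y
    using prod.reindex_bij_betw[OF b, of "\<lambda>j. f j (S (\<phi> j g) y)"] by (simp add: multishift_def \<psi>_def)
  moreover have "\<bar>avg_shift_diff xs h h' (\<lambda>g. I (?p g))\<bar> \<le> e" for h h'
  proof -
    have "\<bar>I (\<lambda>y. avg_shift_diff xs h h' (\<lambda>g. ?p g y))\<bar> \<le> norm2 (\<lambda>y. avg_shift_diff xs h h' (\<lambda>g. ?p g y))"
      by (intro I_abs_le_norm2 V_avg_shift_diff multishift_mem unit)
    also have "\<dots> \<le> e" by (rule xs(2))
    finally show ?thesis by (simp add: I_avg_shift_diff multishift_mem unit)
  qed
  ultimately show ?thesis using that[OF xs(1)] by simp
qed

theorem correlations_almost_convergent: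
  fixes \<phi> :: "'j \<Rightarrow> 'g::ab_group_add \<Rightarrow> 'h"
  assumes "finite J" "\<And>j. j \<in> J \<Longrightarrow> Modules.additive (\<phi> j)"
    and f: "\<And>j. j \<in> J \<Longrightarrow> f j \<in> V" and "0 < e"
  obtains xs where "xs \<noteq> []"
    "\<And>h h'. \<bar>avg_shift_diff xs h h' (\<lambda>g. I (\<lambda>y. \<Prod>j\<in>J. f j (S (\<phi> j g) y)))\<bar> \<le> e"
proof -
  have "\<forall>j\<in>J. \<exists>C. 0 < C \<and> (\<lambda>y. f j y / C) \<in> unit_ball V"
    using ex_scaled_in_unit_ball[OF f] by blast
  then obtain C where C: "\<And>j. j \<in> J \<Longrightarrow> 0 < C j" "\<And>j. j \<in> J \<Longrightarrow> (\<lambda>y. f j y / C j) \<in> unit_ball V"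
    unfolding bchoice_iff by blast
  define K where "K = (\<Prod>j\<in>J. C j)"
  have "0 < K" unfolding K_def by (intro prod_pos C)
  let ?p = "\<lambda>g y. \<Prod>j\<in>J. f j (S (\<phi> j g) y) / C j"
  have p: "?p g \<in> V" for g
    using C(2) V_shift[of "\<lambda>y. f _ y / C _"] by (intro V_prod) (simp add: unit_ball_def)
  obtain xs where xs: "xs \<noteq> []" "\<And>h h'. \<bar>avg_shift_diff xs h h' (\<lambda>g. I (?p g))\<bar> \<le> e / K"
    using unit_correlations_almost_convergent[of J \<phi> "\<lambda>j y. f j y / C j" "e / K"] assms C(2) \<open>0 < K\<close>
    by auto
  have "(\<Prod>j\<in>J. f j (S (\<phi> j g) y)) = K * ?p g y" for g y
    using \<open>0 < K\<close> by (simp add: K_def prod_dividef)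
  then have "avg_shift_diff xs h h' (\<lambda>g. I (\<lambda>y. \<Prod>j\<in>J. f j (S (\<phi> j g) y)))
      = K * avg_shift_diff xs h h' (\<lambda>g. I (?p g))" for h h'
    by (simp add: I_cmult p avg_shift_diff_cmult)
  moreover have "\<bar>K * avg_shift_diff xs h h' (\<lambda>g. I (?p g))\<bar> \<le> e" for h h'
    using xs(2)[of h h'] \<open>0 < K\<close> by (simp add: abs_mult field_simps)
  ultimately show ?thesis using that[OF xs(1)] by simp
qed

end

section \<open>Khintchine recurrence for cubes\<close>

context mean_system
begin

text \<open>Averages of translates of \<open>f\<close> whose energy is almost minimal are almost invariant.\<close>

lemma ex_average_self_correlation_ge:
  assumes "f \<in> V" "0 < e"
  obtains xs where "xs \<noteq> []"
    "\<And>p. (I f)\<^sup>2 - e \<le> I (\<lambda>y. avg xs (\<lambda>x. f (S x y)) * avg xs (\<lambda>x. f (S x (S p y))))"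
proof -
  define A where "A xs y = avg xs (\<lambda>x. f (S x y))" for xs y
  define energy where "energy xs = I (\<lambda>y. (A xs y)\<^sup>2)" for xs
  have A: "A xs \<in> V" for xs unfolding A_def[abs_def] by (intro V_avg V_shift assms(1))
  have energy_ge: "(I f)\<^sup>2 \<le> energy xs" if "xs \<noteq> []" for xs
  proof -
    have "I (A xs) = I f"
      unfolding A_def[abs_def] using that by (simp add: I_avg V_shift I_shift assms(1))
    then show ?thesis using I_power2_le[OF A] by (simp add: energy_def flip: \<open>I (A xs) = I f\<close>)
  qed
  define \<rho> where "\<rho> = Inf (energy ` {xs. xs \<noteq> []})"
  have bdd: "bdd_below (energy ` {xs. xs \<noteq> []})" using energy_ge by (auto intro!: bdd_belowI)
  have ne: "energy ` {xs. xs \<noteq> []} \<noteq> {}" by blast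
  have "(I f)\<^sup>2 \<le> \<rho>" unfolding \<rho>_def using energy_ge ne by (intro cInf_greatest) auto
  obtain xs where xs: "xs \<noteq> []" "energy xs < \<rho> + e"
    using cInf_lessD[OF ne, of "\<rho> + e"] \<open>0 < e\<close> by (auto simp: \<rho>_def)
  have "(I f)\<^sup>2 - e \<le> I (\<lambda>y. A xs y * A xs (S p y))" for p
  proof -
    have midpoint: "A (convolve xs [0, p]) y = (A xs y + A xs (S p y)) / 2" for y
      by (simp add: A_def avg_convolve_right S_add) (simp add: avg_def S_zero)
    have "energy (convolve xs [0, p]) = (energy xs + I (\<lambda>y. A xs y * A xs (S p y))) / 2"
      unfolding energy_def midpoint I_square_midpoint[OF A V_shift[OF A]] I_shift[OF V_square[OF A]]
      by simp
    moreover have "\<rho> \<le> energy (convolve xs [0, p])"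
      unfolding \<rho>_def using xs(1) by (intro cInf_lower bdd imageI) simp
    ultimately show ?thesis using xs(2) \<open>(I f)\<^sup>2 \<le> \<rho>\<close> by simp
  qed
  then show ?thesis using that[OF xs(1)] by (simp add: A_def)
qed

lemma mean_correlation_ge:
  assumes "invariant_mean m" and f: "f \<in> V"
  shows "(I f)\<^sup>2 \<le> m (\<lambda>p. I (\<lambda>y. f y * f (S p y)))"
proof (rule field_le_epsilon)
  interpret m: mean_system bounded_fns m "\<lambda>h x. x + h" by fact
  define b where "b p = I (\<lambda>y. f y * f (S p y))" for p
  have "b \<in> bounded_fns"
    using Cauchy_Schwarz[OF f V_shift[OF f]] by (intro bounded_fnsI) (simp add: b_def norm2_shift f)
  then have b_shift: "(\<lambda>p. b (p + h)) \<in> bounded_fns" for h by (rule m.V_shift)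
  fix e :: real assume "0 < e"
  then obtain xs where xs: "xs \<noteq> []"
    "\<And>p. (I f)\<^sup>2 - e \<le> I (\<lambda>y. avg xs (\<lambda>x. f (S x y)) * avg xs (\<lambda>x. f (S x (S p y))))"
    using ex_average_self_correlation_ge[OF f] by blast
  have "I (\<lambda>y. avg xs (\<lambda>x. f (S x y)) * avg xs (\<lambda>x. f (S x (S p y))))
      = avg xs (\<lambda>x. avg xs (\<lambda>x'. b (p + (x' - x))))" for p
  proof -
    have "I (\<lambda>y. f (S x y) * f (S x' (S p y))) = b (p + (x' - x))" for x x'
      using I_shift_mult[OF f V_shift[OF f], of x "x' + p"] by (simp add: b_def algebra_simps flip: S_add)
    moreover have "I (\<lambda>y. avg xs (\<lambda>x. f (S x y)) * avg xs (\<lambda>x. f (S x (S p y))))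
        = I (\<lambda>y. avg xs (\<lambda>x. avg xs (\<lambda>x'. f (S x y) * f (S x' (S p y)))))"
      by (simp add: avg_cmult avg_cmult_right)
    moreover have "(\<lambda>y. f (S x y) * f (S x' (S p y))) \<in> V" for x x'
      using V_mult[OF V_shift[OF f] V_shift[OF V_shift[OF f]]] .
    then have "I (\<lambda>y. avg xs (\<lambda>x. avg xs (\<lambda>x'. f (S x y) * f (S x' (S p y)))))
        = avg xs (\<lambda>x. avg xs (\<lambda>x'. I (\<lambda>y. f (S x y) * f (S x' (S p y)))))"
      by (simp add: I_avg V_avg)
    ultimately show ?thesis by simp
  qed
  then have "(I f)\<^sup>2 - e \<le> m (\<lambda>p. avg xs (\<lambda>x. avg xs (\<lambda>x'. b (p + (x' - x)))))"
    using xs(2) by (intro m.I_ge bounded_fns.V_avg b_shift) simp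
  also have "\<dots> = avg xs (\<lambda>x. avg xs (\<lambda>x'. m (\<lambda>p. b (p + (x' - x)))))"
    by (simp add: m.I_avg bounded_fns.V_avg b_shift)
  also have "\<dots> = m b" using xs(1) by (simp add: m.I_shift \<open>b \<in> bounded_fns\<close>)
  finally show "(I f)\<^sup>2 \<le> m (\<lambda>p. I (\<lambda>y. f y * f (S p y))) + e" by (simp add: b_def[abs_def])
qed

end

definition cube ::
    "(('y \<Rightarrow> real) \<Rightarrow> real) \<Rightarrow> ('h::comm_monoid_add \<Rightarrow> 'y \<Rightarrow> 'y) \<Rightarrow> nat \<Rightarrow> ('y \<Rightarrow> real) \<Rightarrow> (nat \<Rightarrow> 'h) \<Rightarrow> real" where
  "cube I S k f c = I (\<lambda>y. \<Prod>\<omega>\<in>Pow {..<k}. f (S (\<Sum>i\<in>\<omega>. c i) y))"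

lemma cube_cong:
  assumes "\<And>i. i < k \<Longrightarrow> c i = c' i" shows "cube I S k f c = cube I S k f c'"
proof -
  have "(\<Sum>i\<in>\<omega>. c i) = (\<Sum>i\<in>\<omega>. c' i)" if "\<omega> \<in> Pow {..<k}" for \<omega>
    using that assms by (intro sum.cong) auto
  then show ?thesis by (simp add: cube_def)
qed

context mean_system
begin

lemma cube_mem: "f \<in> V \<Longrightarrow> (\<lambda>y. \<Prod>\<omega>\<in>Pow {..<k}. f (S (\<Sum>i\<in>\<omega>. c i) y)) \<in> V"
  by (intro V_prod V_shift)

lemma cube_abs_le:
  assumes "f \<in> V" "\<And>y. \<bar>f y\<bar> \<le> B" shows "\<bar>cube I S k f c\<bar> \<le> B ^ (2 ^ k)"
  unfolding cube_def
proof (intro I_abs_le cube_mem assms(1))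
  fix y
  have "(\<Prod>\<omega>\<in>Pow {..<k}. \<bar>f (S (\<Sum>i\<in>\<omega>. c i) y)\<bar>) \<le> (\<Prod>\<omega>\<in>Pow {..<k}. B)"
    using assms(2) by (intro prod_mono) auto
  then show "\<bar>\<Prod>\<omega>\<in>Pow {..<k}. f (S (\<Sum>i\<in>\<omega>. c i) y)\<bar> \<le> B ^ (2 ^ k)"
    by (simp add: abs_prod card_Pow)
qed

lemma cube_bounded: "f \<in> V \<Longrightarrow> (\<lambda>j. cube I S k f (c j)) \<in> bounded_fns"
  by (metis V_boundE bounded_fnsI cube_abs_le)

lemma cube_0: "cube I S 0 f c = I f"
  by (simp add: cube_def S_zero)

lemma cube_Suc: "cube I S (Suc k) f c = cube I S k (\<lambda>y. f y * f (S (c k) y)) c"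
proof -
  have "(\<Prod>\<omega>\<in>insert k ` Pow {..<k}. f (S (\<Sum>i\<in>\<omega>. c i) y))
      = (\<Prod>\<omega>\<in>Pow {..<k}. f (S (c k) (S (\<Sum>i\<in>\<omega>. c i) y)))" for y
  proof -
    have "(\<Prod>\<omega>\<in>insert k ` Pow {..<k}. f (S (\<Sum>i\<in>\<omega>. c i) y))
        = (\<Prod>\<omega>\<in>Pow {..<k}. f (S (\<Sum>i\<in>insert k \<omega>. c i) y))"
      by (subst prod.reindex) (auto simp: inj_on_def insert_eq_iff)
    also have "\<dots> = (\<Prod>\<omega>\<in>Pow {..<k}. f (S (c k) (S (\<Sum>i\<in>\<omega>. c i) y)))"
    proof (rule prod.cong[OF refl])
      fix \<omega> assume "\<omega> \<in> Pow {..<k}"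
      then have "finite \<omega>" "k \<notin> \<omega>" using finite_subset by auto
      then show "f (S (\<Sum>i\<in>insert k \<omega>. c i) y) = f (S (c k) (S (\<Sum>i\<in>\<omega>. c i) y))"
        by (simp add: S_add)
    qed
    finally show ?thesis .
  qed
  moreover have "(\<Prod>\<omega>\<in>Pow {..<Suc k}. g \<omega>) = (\<Prod>\<omega>\<in>Pow {..<k}. g \<omega>) * (\<Prod>\<omega>\<in>insert k ` Pow {..<k}. g \<omega>)"
    for g :: "nat set \<Rightarrow> real"
    unfolding lessThan_Suc Pow_insert by (rule prod.union_disjoint) auto
  ultimately show ?thesis by (simp add: cube_def prod.distrib)
qed

end

text \<open>The mean is iterated because cubes are bounded below one coordinate at a time.\<close>

primrec tuple_mean :: "(('h::zero \<Rightarrow> real) \<Rightarrow> real) \<Rightarrow> nat \<Rightarrow> ((nat \<Rightarrow> 'h) \<Rightarrow> real) \<Rightarrow> real" where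
  "tuple_mean m 0 a = a (\<lambda>_. 0)"
| "tuple_mean m (Suc k) a = m (\<lambda>p. tuple_mean m k (\<lambda>c. a (c(k := p))))"

lemma mean_tuple_mean:
  assumes "mean bounded_fns m" shows "mean bounded_fns (tuple_mean m k)"
proof (induction k)
  case 0
  show ?case by unfold_locales auto
next
  case (Suc k)
  have "tuple_mean m (Suc k) = fibre_mean (\<lambda>p c. c(k := p)) m (tuple_mean m k)"
    by (simp add: fibre_mean_def fun_eq_iff)
  then show ?case using mean_fibre_mean[OF Suc.IH assms, of "\<lambda>p c. c(k := p)"] by simp
qed

lemma tuple_mean_shift:
  assumes "invariant_mean m" "a \<in> bounded_fns"
    and "\<And>c c'. (\<And>i. i < k \<Longrightarrow> c i = c' i) \<Longrightarrow> a c = a c'"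
  shows "tuple_mean m k (\<lambda>c. a (b + c)) = tuple_mean m k a"
  using assms(2,3)
proof (induction k arbitrary: a)
  case 0
  show ?case unfolding tuple_mean.simps by (rule "0.prems"(2)) simp
next
  case (Suc k)
  interpret m: mean_system bounded_fns m "\<lambda>h x. x + h" by fact
  interpret tuple: mean bounded_fns "tuple_mean m k" by (rule mean_tuple_mean) (rule m.mean_axioms)
  define a' where "a' p c = a (c(k := p))" for p c
  have a': "a' p \<in> bounded_fns" for p
    using bounded_fns_compose[OF Suc.prems(1)] by (simp add: a'_def[abs_def])
  have tuple_shift: "tuple_mean m k (\<lambda>c. a' p (b + c)) = tuple_mean m k (a' p)" for p
    using a' by (rule Suc.IH) (auto simp: a'_def less_Suc_eq intro!: Suc.prems(2))
  have "b + c(k := p) = (b + c)(k := p + b k)" for c p by (auto simp: fun_eq_iff add.commute)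
  then have "tuple_mean m (Suc k) (\<lambda>c. a (b + c)) = m (\<lambda>p. tuple_mean m k (a' (p + b k)))"
    by (simp add: a'_def flip: tuple_shift)
  also have "m (\<lambda>p. tuple_mean m k (a' (p + b k))) = m (\<lambda>p. tuple_mean m k (a' p))"
  proof (rule m.I_shift)
    show "(\<lambda>p. tuple_mean m k (a' p)) \<in> bounded_fns"
      using tuple.fibre_integral_bounded[of a "\<lambda>p c. c(k := p)"] Suc.prems(1)
      by (simp add: a'_def[abs_def])
  qed
  finally show ?case by (simp only: tuple_mean.simps a'_def[abs_def])
qed

context mean_system
begin

lemma tuple_mean_cube_ge:
  assumes m: "invariant_mean m" and "f \<in> V" "\<And>y. 0 \<le> f y"
  shows "I f ^ (2 ^ k) \<le> tuple_mean m k (cube I S k f)"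
  using assms(2,3)
proof (induction k arbitrary: f)
  case 0
  then show ?case by (simp add: cube_0)
next
  case (Suc k)
  interpret m: mean_system bounded_fns m "\<lambda>h x. x + h" by fact
  interpret tuple: mean bounded_fns "tuple_mean m k" by (rule mean_tuple_mean) (rule m.mean_axioms)
  define F where "F p y = f y * f (S p y)" for p y
  have F: "F p \<in> V" "0 \<le> F p y" for p y
    unfolding F_def[abs_def] using Suc.prems by (auto intro: V_mult V_shift)
  have cube_Suc_upd: "cube I S (Suc k) f (c(k := p)) = cube I S k (F p) c" for c p
    unfolding cube_Suc F_def[abs_def] by (simp, rule cube_cong) simp
  have IF: "(\<lambda>p. I (F p)) \<in> bounded_fns"
    using Cauchy_Schwarz[OF Suc.prems(1) V_shift[OF Suc.prems(1)]]
    by (intro bounded_fnsI) (simp add: F_def[abs_def] norm2_shift Suc.prems(1))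
  have "I f ^ (2 ^ Suc k) = ((I f)\<^sup>2) ^ (2 ^ k)" by (simp add: power_mult)
  also have "\<dots> \<le> m (\<lambda>p. I (F p)) ^ (2 ^ k)"
    using mean_correlation_ge[OF m Suc.prems(1)] by (intro power_mono) (simp_all add: F_def[abs_def])
  also have "\<dots> \<le> m (\<lambda>p. I (F p) ^ (2 ^ k))"
    using m.I_power_two_power_le[OF IF] I_nonneg F by simp
  also have "\<dots> \<le> m (\<lambda>p. tuple_mean m k (cube I S k (F p)))"
  proof (rule m.I_mono)
    show "(\<lambda>p. I (F p) ^ (2 ^ k)) \<in> bounded_fns" using m.I_power_two_power_le[OF IF] I_nonneg F by simp
    show "(\<lambda>p. tuple_mean m k (cube I S k (F p))) \<in> bounded_fns"
      using tuple.fibre_integral_bounded[of "cube I S (Suc k) f" "\<lambda>p c. c(k := p)"]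
        cube_bounded[OF Suc.prems(1), of "Suc k" "\<lambda>c. c"] by (simp add: cube_Suc_upd)
    show "I (F p) ^ (2 ^ k) \<le> tuple_mean m k (cube I S k (F p))" for p using F by (rule Suc.IH)
  qed
  finally show ?case by (simp add: cube_Suc_upd)
qed

end

lemma ex_list_superlevel:
  fixes a :: "'g::ab_group_add \<Rightarrow> real"
  assumes "mean bounded_fns m" "a \<in> bounded_fns" and invariant: "\<And>x. m (\<lambda>h. a (x + h)) = m a"
    and "0 < e" and "xs \<noteq> []" "\<And>h h'. \<bar>avg_shift_diff xs h h' a\<bar> \<le> e / 2"
  shows "\<exists>x\<in>set xs. m a - e < a (x + h)"
proof (rule ccontr)
  interpret m: mean bounded_fns m by fact
  assume "\<not> ?thesis"
  then have small: "avg xs (\<lambda>x. a (x + h)) \<le> m a - e" by (intro avg_le \<open>xs \<noteq> []\<close>) (auto simp: not_less)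
  have shifts: "(\<lambda>h'. a (x + h')) \<in> bounded_fns" for x using assms(2) by (rule bounded_fns_compose)
  have "m a = m (\<lambda>h'. avg xs (\<lambda>x. a (x + h')))"
    using \<open>xs \<noteq> []\<close> by (simp add: m.I_avg shifts invariant)
  also have "\<dots> \<le> m a - e / 2"
  proof (intro m.I_le bounded_fns.V_avg shifts)
    fix h' show "avg xs (\<lambda>x. a (x + h')) \<le> m a - e / 2"
      using assms(6)[of h' h] small unfolding avg_shift_diff_def abs_le_iff by (simp add: field_simps)
  qed
  finally show False using \<open>0 < e\<close> by simp
qed

lemma (in mean_system) ex_list_large_cubes:
  assumes "f \<in> V" "\<And>y. 0 \<le> f y" "0 < e"
  obtains bs :: "(nat \<Rightarrow> 'h) list" where "\<And>c. \<exists>b\<in>set bs. I f ^ (2 ^ k) - e < cube I S k f (b + c)"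
proof -
  obtain m :: "('h \<Rightarrow> real) \<Rightarrow> real" where m: "invariant_mean m" using ex_invariant_mean by blast
  interpret m: mean_system bounded_fns m "\<lambda>h x. x + h" by fact
  have mean: "mean bounded_fns (tuple_mean m k)" using m.mean_axioms by (rule mean_tuple_mean)
  have additive: "Modules.additive (\<lambda>c :: nat \<Rightarrow> 'h. \<Sum>i\<in>\<omega>. c i)" for \<omega>
    by (simp add: Modules.additive_def sum.distrib)
  have "finite (Pow {..<k})" "0 < e / 2" using \<open>0 < e\<close> by auto
  then obtain bs :: "(nat \<Rightarrow> 'h) list" where bs: "bs \<noteq> []"
    "\<And>h h'. \<bar>avg_shift_diff bs h h' (cube I S k f)\<bar> \<le> e / 2"
    unfolding cube_def[abs_def]
    using correlations_almost_convergent[of "Pow {..<k}" "\<lambda>\<omega> c. \<Sum>i\<in>\<omega>. c i" "\<lambda>_. f" "e / 2"]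
      additive assms(1) by blast
  have invariant: "tuple_mean m k (\<lambda>c. cube I S k f (b + c)) = tuple_mean m k (cube I S k f)" for b
    using m cube_bounded[OF assms(1), of k "\<lambda>c. c"] cube_cong by (rule tuple_mean_shift)
  have "\<exists>b\<in>set bs. tuple_mean m k (cube I S k f) - e < cube I S k f (b + c)" for c
    using mean cube_bounded[OF assms(1), of k "\<lambda>c. c"] invariant assms(3) bs by (rule ex_list_superlevel)
  then show ?thesis using that tuple_mean_cube_ge[OF m assms(1,2)] by (meson diff_right_mono le_less_trans)
qed

section \<open>Syndetic sets of tuples of endomorphisms\<close>

lemma syndetic_discreteI:
  assumes "\<And>h. \<exists>x\<in>set xs. x + h \<in> R" shows "syndetic_discrete R"
proof -
  have "h \<in> (\<Union>f\<in>uminus ` set xs. (\<lambda>r. f + r) ` R)" for h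
  proof -
    obtain x where "x \<in> set xs" "x + h \<in> R" using assms by blast
    moreover have "h = - x + (x + h)" by simp
    ultimately show ?thesis by blast
  qed
  then show ?thesis unfolding syndetic_discrete_def by (intro exI[of _ "uminus ` set xs"]) auto
qed

lemma syndetic_discrete_mono:
  assumes "syndetic_discrete R" "R \<subseteq> R'" shows "syndetic_discrete R'"
proof -
  obtain F where F: "finite F" "(\<Union>f\<in>F. (\<lambda>r. f + r) ` R) = UNIV"
    using assms(1) by (auto simp: syndetic_discrete_def)
  have "(\<Union>f\<in>F. (\<lambda>r. f + r) ` R) \<subseteq> (\<Union>f\<in>F. (\<lambda>r. f + r) ` R')"
    using assms(2) by (intro UN_mono image_mono) auto
  then show ?thesis unfolding syndetic_discrete_def using F by (intro exI[of _ F]) auto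
qed

lemma Hom_iff_additive: "\<psi> \<in> Hom \<longleftrightarrow> Modules.additive \<psi>"
  by (simp add: Hom_def Modules.additive_def)

lemma topspace_homk_top: "topspace (homk_top k) = (\<Pi>\<^sub>E i\<in>{..<k}. Hom)"
  by (simp add: homk_top_def hom_top_def)

lemma Hom_uminus: "\<psi> \<in> Hom \<Longrightarrow> (\<lambda>g. - \<psi> g) \<in> Hom"
  by (simp add: Hom_def)

lemma Hom_add: "\<psi> \<in> Hom \<Longrightarrow> \<psi>' \<in> Hom \<Longrightarrow> (\<lambda>g. \<psi> g + \<psi>' g) \<in> Hom"
  by (simp add: Hom_def algebra_simps)

lemma tuple_add_mem:
  "s \<in> topspace (homk_top k) \<Longrightarrow> c \<in> topspace (homk_top k) \<Longrightarrow> tuple_add k s c \<in> topspace (homk_top k)"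
  by (auto simp: topspace_homk_top tuple_add_def PiE_iff intro!: Hom_add)

lemma syndetic_homkI:
  assumes "finite B" "B \<subseteq> topspace (homk_top k)" "S \<subseteq> topspace (homk_top k)"
    and cover: "\<And>\<phi>. \<phi> \<in> topspace (homk_top k) \<Longrightarrow> \<exists>b\<in>B. tuple_add k \<phi> b \<in> S"
  shows "syndetic_homk k S"
proof -
  define minus where "minus b = (\<lambda>i\<in>{..<k}. \<lambda>g. - b i g)" for b :: "nat \<Rightarrow> 'a \<Rightarrow> 'a"
  have minus: "minus ` B \<subseteq> topspace (homk_top k)"
    using assms(2) by (force simp: topspace_homk_top minus_def PiE_iff intro!: Hom_uminus)
  have "topspace (homk_top k) = {tuple_add k s c | s c. s \<in> S \<and> c \<in> minus ` B}"
  proof (intro equalityI subsetI)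
    fix \<phi> :: "nat \<Rightarrow> 'a \<Rightarrow> 'a" assume \<phi>: "\<phi> \<in> topspace (homk_top k)"
    then obtain b where "b \<in> B" "tuple_add k \<phi> b \<in> S" using cover by blast
    moreover have "\<phi> = tuple_add k (tuple_add k \<phi> b) (minus b)"
      using \<phi> by (auto simp: topspace_homk_top tuple_add_def minus_def PiE_def extensional_def fun_eq_iff)
    ultimately show "\<phi> \<in> {tuple_add k s c | s c. s \<in> S \<and> c \<in> minus ` B}" by blast
  next
    fix \<phi> assume "\<phi> \<in> {tuple_add k s c | s c. s \<in> S \<and> c \<in> minus ` B}"
    then show "\<phi> \<in> topspace (homk_top k)" using minus assms(3) tuple_add_mem by blast
  qed
  moreover have "compactin (homk_top k) (minus ` B)"
    using minus \<open>finite B\<close> by (intro finite_imp_compactin) auto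
  ultimately show ?thesis unfolding syndetic_homk_def by blast
qed

typedef (overloaded) 'g endo = "Hom :: ('g::ab_group_add \<Rightarrow> 'g) set" morphisms app Endo
  by (rule exI[of _ "\<lambda>_. 0"]) (simp add: Hom_def)

instantiation endo :: (ab_group_add) ab_group_add
begin

definition "0 = Endo (\<lambda>_. 0)"
definition "\<psi> + \<psi>' = Endo (\<lambda>g. app \<psi> g + app \<psi>' g)"
definition "- \<psi> = Endo (\<lambda>g. - app \<psi> g)"
definition "\<psi> - \<psi>' = Endo (\<lambda>g. app \<psi> g - app \<psi>' g)"

lemma app_zero: "app 0 g = 0"
  by (simp add: zero_endo_def Endo_inverse Hom_def)

lemma app_plus: "app (\<psi> + \<psi>') g = app \<psi> g + app \<psi>' g"
  by (simp add: plus_endo_def Endo_inverse Hom_add app)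

lemma app_uminus: "app (- \<psi>) g = - app \<psi> g"
  by (simp add: uminus_endo_def Endo_inverse Hom_uminus app)

lemma app_minus: "app (\<psi> - \<psi>') g = app \<psi> g - app \<psi>' g"
  using Hom_add[OF app[of \<psi>] Hom_uminus[OF app[of \<psi>']]]
  by (simp add: minus_endo_def Endo_inverse)

instance
  by standard
    (simp_all add: app_inject[symmetric] fun_eq_iff app_zero app_plus app_uminus app_minus algebra_simps)

end

lemma app_sum: "app (\<Sum>i\<in>\<omega>. c i) g = (\<Sum>i\<in>\<omega>. app (c i) g)"
  by (induction \<omega> rule: infinite_finite_induct) (auto simp: app_zero app_plus)

context mean_system
begin

lemma syndetic_large_cubes:
  fixes \<phi> :: "nat \<Rightarrow> 'g::ab_group_add \<Rightarrow> 'h"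
  assumes "invariant_mean m" "\<And>i. i < k \<Longrightarrow> Modules.additive (\<phi> i)" "f \<in> V" "0 < e"
  shows "syndetic_discrete
    {g. m (\<lambda>g. cube I S k f (\<lambda>i. \<phi> i g)) - e < cube I S k f (\<lambda>i. \<phi> i g)}"
proof -
  interpret m: mean_system bounded_fns m "\<lambda>h x. x + h" by fact
  define a where "a g = cube I S k f (\<lambda>i. \<phi> i g)" for g
  have a: "a \<in> bounded_fns"
    using cube_bounded[OF assms(3), of k "\<lambda>g i. \<phi> i g"] by (simp add: a_def[abs_def])
  have additive: "Modules.additive (\<lambda>g. \<Sum>i\<in>\<omega>. \<phi> i g)" if "\<omega> \<in> Pow {..<k}" for \<omega>
  proof
    have "\<phi> i (g + h) = \<phi> i g + \<phi> i h" if "i \<in> \<omega>" for i g h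
      using that \<open>\<omega> \<in> Pow {..<k}\<close> by (intro additive.add assms(2)) auto
    then show "(\<Sum>i\<in>\<omega>. \<phi> i (g + h)) = (\<Sum>i\<in>\<omega>. \<phi> i g) + (\<Sum>i\<in>\<omega>. \<phi> i h)" for g h
      by (simp add: sum.distrib)
  qed
  have "finite (Pow {..<k})" "0 < e / 2" using \<open>0 < e\<close> by auto
  then obtain xs where xs: "xs \<noteq> []" "\<And>h h'. \<bar>avg_shift_diff xs h h' a\<bar> \<le> e / 2"
    unfolding a_def[abs_def] cube_def
    using correlations_almost_convergent[of "Pow {..<k}" "\<lambda>\<omega> g. \<Sum>i\<in>\<omega>. \<phi> i g" "\<lambda>_. f" "e / 2"]
      additive assms(3) by blast
  have "m (\<lambda>h. a (x + h)) = m a" for x using m.I_shift[OF a, of x] by (simp add: add.commute)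
  then have "\<exists>x\<in>set xs. m a - e < a (x + h)" for h
    using m.mean_axioms a \<open>0 < e\<close> xs by (intro ex_list_superlevel)
  then have "syndetic_discrete {g. m a - e < a g}" by (intro syndetic_discreteI) simp
  then show ?thesis by (simp add: a_def[abs_def])
qed

end

text \<open>The mean over \<^term>\<open>g\<close> of the cubes along \<open>\<phi>\<^sub>i(g)\<close> is a cube for the action
  \<open>(g, y) \<mapsto> (g, S\<^bsub>\<psi>(g)\<^esub> y)\<close> of the endomorphisms.\<close>

lemma ex_list_large_mean_cubes:
  fixes S :: "'g::ab_group_add \<Rightarrow> 'y \<Rightarrow> 'y"
  assumes "mean_system V I S" "mean bounded_fns m" "f \<in> V" "\<And>y. 0 \<le> f y" "0 < e"
  obtains bs :: "(nat \<Rightarrow> 'g endo) list"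
  where "\<And>c. \<exists>b\<in>set bs. I f ^ (2 ^ k) - e < m (\<lambda>g. cube I S k f (\<lambda>i. app (b i + c i) g))"
proof -
  interpret mean_system V I S by fact
  let ?V = "fibre_fns Pair V" and ?I = "fibre_mean Pair m I"
  let ?S = "\<lambda>(\<psi> :: 'g endo) (g, y). (g, S (app \<psi> g) y)"
  interpret m: mean bounded_fns m by fact
  interpret endo: mean_system ?V ?I ?S
    using assms(1,2) by (rule mean_system_fibre_mean[where \<theta> = app])
      (auto simp: app_zero app_plus S_zero S_add)
  have cube: "cube ?I ?S k (\<lambda>p. f (snd p)) c = m (\<lambda>g. cube I S k f (\<lambda>i. app (c i) g))" for c
    by (simp add: cube_def fibre_mean_def app_sum)
  obtain C where "0 < C" "\<And>y. \<bar>f y\<bar> \<le> C" using V_boundE[OF assms(3)] by blast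
  then have "(\<lambda>p. f (snd p)) \<in> ?V" using assms(3) by (intro fibre_fnsI[of _ C]) auto
  then obtain bs :: "(nat \<Rightarrow> 'g endo) list" where
    bs: "\<And>c. \<exists>b\<in>set bs. ?I (\<lambda>p. f (snd p)) ^ (2 ^ k) - e < cube ?I ?S k (\<lambda>p. f (snd p)) (b + c)"
    using endo.ex_list_large_cubes[OF _ assms(4,5)] by blast
  have "?I (\<lambda>p. f (snd p)) = I f" by (simp add: fibre_mean_def)
  then show ?thesis using that[of bs] bs unfolding cube plus_fun_apply by simp
qed

lemma syndetic_homk_large_mean_cubes:
  fixes S :: "'g::ab_group_add \<Rightarrow> 'y \<Rightarrow> 'y"
  assumes "mean_system V I S" "mean bounded_fns m" "f \<in> V" "\<And>y. 0 \<le> f y" "0 < e"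
  shows "syndetic_homk k
    {\<phi> \<in> topspace (homk_top k). I f ^ (2 ^ k) - e < m (\<lambda>g. cube I S k f (\<lambda>i. \<phi> i g))}"
proof -
  obtain bs :: "(nat \<Rightarrow> 'g endo) list"
    where bs: "\<And>c. \<exists>b\<in>set bs. I f ^ (2 ^ k) - e < m (\<lambda>g. cube I S k f (\<lambda>i. app (b i + c i) g))"
    using ex_list_large_mean_cubes[OF assms] by blast
  define hom where "hom b = (\<lambda>i\<in>{..<k}. app (b i))" for b :: "nat \<Rightarrow> 'g endo"
  have hom: "hom b \<in> topspace (homk_top k)" for b
    by (auto simp: hom_def topspace_homk_top app)
  show ?thesis
  proof (rule syndetic_homkI[where B = "hom ` set bs"])
    fix \<phi> :: "nat \<Rightarrow> 'g \<Rightarrow> 'g" assume \<phi>: "\<phi> \<in> topspace (homk_top k)"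
    obtain b where b: "b \<in> set bs"
      "I f ^ (2 ^ k) - e < m (\<lambda>g. cube I S k f (\<lambda>i. app (b i + Endo (\<phi> i)) g))"
      using bs[of "\<lambda>i. Endo (\<phi> i)"] by blast
    have "app (Endo (\<phi> i)) = \<phi> i" if "i < k" for i
      using \<phi> that by (intro Endo_inverse) (auto simp: topspace_homk_top)
    then have "cube I S k f (\<lambda>i. app (b i + Endo (\<phi> i)) g)
        = cube I S k f (\<lambda>i. tuple_add k \<phi> (hom b) i g)" for g
      by (intro cube_cong) (simp add: tuple_add_def hom_def app_plus add.commute)
    then show "\<exists>b\<in>hom ` set bs. tuple_add k \<phi> b
        \<in> {\<phi> \<in> topspace (homk_top k). I f ^ (2 ^ k) - e < m (\<lambda>g. cube I S k f (\<lambda>i. \<phi> i g))}"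
      using b tuple_add_mem[OF \<phi> hom] by (intro bexI[of _ "hom b"]) auto
  qed (use hom in auto)
qed

theorem ex_syndetic_homk_large_cubes:
  fixes S :: "'g::ab_group_add \<Rightarrow> 'y \<Rightarrow> 'y"
  assumes "mean_system V I S" "f \<in> V" "\<And>y. 0 \<le> f y" "0 < e"
  obtains D where "D \<subseteq> topspace (homk_top k)" "syndetic_homk k D"
    "\<And>\<phi>. \<phi> \<in> D \<Longrightarrow> syndetic_discrete {g. I f ^ (2 ^ k) - e < cube I S k f (\<lambda>i. \<phi> i g)}"
proof -
  interpret mean_system V I S by fact
  obtain m :: "('g \<Rightarrow> real) \<Rightarrow> real" where m: "invariant_mean m" using ex_invariant_mean by blast
  interpret m: mean_system bounded_fns m "\<lambda>h x. x + h" by fact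
  let ?cube = "\<lambda>\<phi> g. cube I S k f (\<lambda>i. \<phi> i g)"
  define D where "D = {\<phi> \<in> topspace (homk_top k). I f ^ (2 ^ k) - e / 2 < m (?cube \<phi>)}"
  have "0 < e / 2" using \<open>0 < e\<close> by simp
  have "syndetic_discrete {g. I f ^ (2 ^ k) - e < ?cube \<phi> g}" if "\<phi> \<in> D" for \<phi>
  proof (rule syndetic_discrete_mono)
    have "Modules.additive (\<phi> i)" if "i < k" for i
      using \<open>\<phi> \<in> D\<close> that by (auto simp: D_def topspace_homk_top simp flip: Hom_iff_additive)
    then show "syndetic_discrete {g. m (?cube \<phi>) - e / 2 < ?cube \<phi> g}"
      using m assms(2) \<open>0 < e / 2\<close> by (intro syndetic_large_cubes)
    show "{g. m (?cube \<phi>) - e / 2 < ?cube \<phi> g} \<subseteq> {g. I f ^ (2 ^ k) - e < ?cube \<phi> g}"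
      using \<open>\<phi> \<in> D\<close> by (auto simp: D_def)
  qed
  moreover have "syndetic_homk k D"
    unfolding D_def using assms(1) m.mean_axioms assms(2,3) \<open>0 < e / 2\<close>
    by (rule syndetic_homk_large_mean_cubes)
  moreover have "D \<subseteq> topspace (homk_top k)" by (auto simp: D_def)
  ultimately show ?thesis using that by blast
qed

section \<open>Measure-preserving systems\<close>

text \<open>\<^term>\<open>T\<close> is only assumed to be an action on \<^term>\<open>space M\<close>.\<close>

definition total_action :: "'x measure \<Rightarrow> ('g \<Rightarrow> 'x \<Rightarrow> 'x) \<Rightarrow> 'g \<Rightarrow> 'x \<Rightarrow> 'x" where
  "total_action M T g x = (if x \<in> space M then T g x else x)"

lemma (in prob_space) mean_integral: "mean (borel_measurable M \<inter> bounded_fns) (integral\<^sup>L M)"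
proof -
  have integrable: "integrable M f" if f: "f \<in> borel_measurable M \<inter> bounded_fns" for f :: "'a \<Rightarrow> real"
  proof -
    obtain C where "0 < C" "\<And>x. \<bar>f x\<bar> \<le> C" using f bounded_fnsE[of f] by blast
    then show ?thesis using f by (intro integrable_const_bound[of _ C]) auto
  qed
  interpret function_algebra "borel_measurable M \<inter> bounded_fns"
    by unfold_locales (auto intro: bounded_fns.V_const bounded_fns.V_add bounded_fns.V_mult)
  show ?thesis by unfold_locales (simp_all add: integrable prob_space)
qed

lemma mp_G_system_mean_system:
  assumes "mp_G_system M T"
  shows "mean_system (borel_measurable M \<inter> bounded_fns) (integral\<^sup>L M) (total_action M T)"
proof -
  interpret prob_space M using assms by (simp add: mp_G_system_def)
  have T: "T g \<in> measurable M M" "distr M M (T g) = M" for g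
    using assms by (auto simp: mp_G_system_def)
  interpret mean "borel_measurable M \<inter> bounded_fns" "integral\<^sup>L M" by (rule mean_integral)
  show ?thesis
  proof
    fix f :: "'a \<Rightarrow> real" and h assume f: "f \<in> borel_measurable M \<inter> bounded_fns"
    have "(\<lambda>x. f (total_action M T h x)) \<in> borel_measurable M"
      using measurable_compose[OF T(1)[of h], of f borel] f
      by (subst measurable_cong[of M _ "\<lambda>x. f (T h x)"]) (auto simp: total_action_def)
    then show "(\<lambda>x. f (total_action M T h x)) \<in> borel_measurable M \<inter> bounded_fns"
      using f bounded_fns_compose by auto
    have "(\<integral>x. f (total_action M T h x) \<partial>M) = (\<integral>x. f (T h x) \<partial>M)"
      by (intro Bochner_Integration.integral_cong) (auto simp: total_action_def)
    also have "\<dots> = (\<integral>x. f x \<partial>distr M M (T h))" using f T(1) by (intro integral_distr[symmetric]) auto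
    finally show "(\<integral>x. f (total_action M T h x) \<partial>M) = integral\<^sup>L M f" by (simp add: T(2))
  next
    show "total_action M T 0 x = x" for x using assms by (simp add: total_action_def mp_G_system_def)
    show "total_action M T (a + b) x = total_action M T a (total_action M T b x)" for a b x
      using assms measurable_space[OF T(1)] by (simp add: total_action_def mp_G_system_def)
  qed
qed

lemma prod_indicator_eq_indicator_INT:
  assumes "finite J" shows "(\<Prod>j\<in>J. indicator (B j) x) = (indicator (\<Inter>j\<in>J. B j) x :: 'a::comm_semiring_1)"
  using assms by (induction J rule: finite_induct) (auto simp: indicator_inter_arith)

lemma cube_indicator:
  "cube (integral\<^sup>L M) (total_action M T) k (indicator A) c
    = measure M (\<Inter>\<omega>\<in>Pow {..<k}. T (\<Sum>i\<in>\<omega>. c i) -` A \<inter> space M)"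
proof -
  let ?B = "\<Inter>\<omega>\<in>Pow {..<k}. T (\<Sum>i\<in>\<omega>. c i) -` A \<inter> space M"
  have "cube (integral\<^sup>L M) (total_action M T) k (indicator A) c = (\<integral>x. indicator ?B x \<partial>M)"
    unfolding cube_def
  proof (rule Bochner_Integration.integral_cong[OF refl])
    fix x assume "x \<in> space M"
    then have "(\<Prod>\<omega>\<in>Pow {..<k}. indicator A (total_action M T (\<Sum>i\<in>\<omega>. c i) x) :: real)
        = (\<Prod>\<omega>\<in>Pow {..<k}. indicator (T (\<Sum>i\<in>\<omega>. c i) -` A \<inter> space M) x)"
      by (intro prod.cong) (auto simp: total_action_def indicator_def)
    then show "(\<Prod>\<omega>\<in>Pow {..<k}. indicator A (total_action M T (\<Sum>i\<in>\<omega>. c i) x)) = (indicator ?B x :: real)"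
      by (simp only: prod_indicator_eq_indicator_INT finite_Pow_iff finite_lessThan)
  qed
  also have "\<dots> = measure M (?B \<inter> space M)" by simp
  also have "?B \<inter> space M = ?B" by blast
  finally show ?thesis .
qed

lemma R_eps_eq_cube:
  "R_eps M T A k \<epsilon> \<phi> = {g. measure M A ^ (2 ^ k) - \<epsilon>
    < cube (integral\<^sup>L M) (total_action M T) k (indicator A) (\<lambda>i. \<phi> i g)}"
  unfolding R_eps_def cube_indicator ..

theorem theorem13p3:
  fixes M :: "'x measure" and T :: "'g::{countable, ab_group_add} \<Rightarrow> 'x \<Rightarrow> 'x"
    and A :: "'x set" and k :: nat and \<epsilon> :: real
  assumes "mp_G_system M T"
    and "A \<in> sets M"
    and "\<epsilon> > 0"
  shows "\<exists>S. S \<subseteq> topspace (homk_top k) \<and> syndetic_homk k S \<and>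
           (\<forall>\<phi>\<in>S. syndetic_discrete (R_eps M T A k \<epsilon> \<phi>))"
proof -
  let ?f = "indicator A :: 'x \<Rightarrow> real"
  have "?f \<in> borel_measurable M \<inter> bounded_fns" "\<And>x. 0 \<le> ?f x"
    using assms(2) by (auto intro!: bounded_fnsI[of _ 1] split: split_indicator)
  then obtain S where "S \<subseteq> topspace (homk_top k)" "syndetic_homk k S"
    "\<And>\<phi>. \<phi> \<in> S \<Longrightarrow> syndetic_discrete {g. (integral\<^sup>L M ?f) ^ (2 ^ k) - \<epsilon>
      < cube (integral\<^sup>L M) (total_action M T) k ?f (\<lambda>i. \<phi> i g)}"
    using ex_syndetic_homk_large_cubes[OF mp_G_system_mean_system[OF assms(1)] _ _ assms(3)] by blast
  moreover have "integral\<^sup>L M ?f = measure M A" using assms(2) by simp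
  ultimately show ?thesis unfolding R_eps_eq_cube by auto
qed

end
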